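(* Let $D<-4$ be a fundamental discriminant and $\mathfrak z=\mathfrak z_D$, and let $K,k_0,k_1,k_2,k_3,m_1,m_2,a_1,\dots,a_4$ be as in the context. Then for all $n\ge0$, $$c_{\mathfrak z}(\Delta,n)=-|D|^3\Delta(\mathfrak z)\Big(\frac{-\pi\Omega_D^2}{6k_0^4k_2^2m_2}\Big)^n\frac{q_n(0)}{n!},$$ where $q_n\in\mathcal O_K[t]$ satisfy $q_0=1$, $q_1=a_1$, and $q_{n+1}=(a_1+n\,a_2)q_n+a_3q_n'+n(n+11)a_4q_{n-1}$ for $n\ge1$.
   Context: $D<0$ fundamental discriminant: $D\equiv1\bmod4$ squarefree, or $D=4m$, $m\equiv2,3\bmod4$ squarefree; $\mathfrak z_D=\sqrt D/2$ ($D$ even) or $(1+\sqrt D)/2$ ($D$ odd). $\Omega_D=\frac1{\sqrt{2\pi|D|}}\big[\prod_{j=1}^{|D|-1}\Gamma(j/|D|)^{(D/j)}\big]^{1/(2h(D))}$ with $(D/j)$ the Kronecker symbol and $h(D)$ the class number of $\mathbb Q(\sqrt D)$. $E_2=1-24\sum_{n\ge1}\sigma_1(n)q^n$, $E_2^*(z)=E_2(z)-3/(\pi\mathrm{Im}z)$, $Q=E_4$, $R=E_6$ normalized Eisenstein series, $q=e^{2\pi iz}$, $\Delta=q\prod(1-q^n)^{24}$. Define $k_1,k_2,k_3$ by $E_2^*(\mathfrak z)=k_1|D|^{-1/2}\Omega_D^2$, $Q(\mathfrak z)=k_2\Omega_D^4$, $R(\mathfrak z)=k_3|D|^{1/2}\Omega_D^6$;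 they are non-zero algebraic numbers, and $K$ is a number field containing them. $k_0\in\mathbb Z_{>0}$ is such that $k_0k_1,k_0k_2,k_0k_3|D|\in\mathcal O_K$. $m_1=k_0^2k_1k_2$, $m_2=k_0^2|D|k_3$, with any common factor in $\mathbb Z_{>1}$ removed. Then $a_1(t)=12k_0^4k_2m_1|D|(t+k_3)$, $a_2(t)=2k_0^4k_2(m_1-m_2)|D|(t+k_3)$, $a_3(t)=6k_0^4m_2\big(k_2|D|(t+k_3)^2-k_2^4\big)$, $a_4(t)=-k_0^8k_2^5m_2(m_2-6m_1)|D|-k_0^8k_2^2m_1(4m_2+m_1)|D|^2(t+k_3)^2$. For $z_0=\alpha+i\beta$, $\sigma_{z_0}=\frac1{2i\beta}\begin{pmatrix}-\overline{z_0}&z_0\\-1&1\end{pmatrix}$, $(f|_{12}\gamma)(z)=\det(\gamma)^6f(\gamma z)(cz+d)^{-12}$, and $(\Delta|_{12}\sigma_{z_0})(w)=\sum_{n\ge0}c_{z_0}(\Delta,n)w^n$. *)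

theory Defs
  imports
    "HOL-Complex_Analysis.Complex_Analysis"
    "HOL-Computational_Algebra.Computational_Algebra"
    "HOL-Number_Theory.Number_Theory"
    "HOL-Algebra.Ideal"
    "HOL-Algebra.Embedded_Algebras"
begin

text \<open>Number fields are taken inside the complex numbers, which are viewed as a HOL-Algebra ring so
  that subfields, dimensions and ideals are those of the library.\<close>

definition complex_ring :: "complex ring" where
  "complex_ring = \<lparr>carrier = UNIV, mult = (*), one = 1, zero = 0, add = (+)\<rparr>"

definition number_field :: "complex set \<Rightarrow> bool" where
  "number_field K \<longleftrightarrow> subfield K complex_ring \<and> ring.finite_dimension complex_ring \<rat> K"

definition ring_of_integers :: "complex set \<Rightarrow> complex set" where
  "ring_of_integers K = {x \<in> K. algebraic_int x}"

definition nonzero_ideals :: "complex set \<Rightarrow> complex set set" where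
  "nonzero_ideals K =
     {J. ideal J (complex_ring\<lparr>carrier := ring_of_integers K\<rparr>) \<and> J \<noteq> {0}}"

definition ideal_class_rel :: "complex set \<Rightarrow> (complex set \<times> complex set) set" where
  "ideal_class_rel K =
     {(I, J). I \<in> nonzero_ideals K \<and> J \<in> nonzero_ideals K \<and>
        (\<exists>a \<in> ring_of_integers K - {0}. \<exists>b \<in> ring_of_integers K - {0}.
           (*) a ` I = (*) b ` J)}"

definition class_number :: "complex set \<Rightarrow> nat" where
  "class_number K = card (nonzero_ideals K // ideal_class_rel K)"

definition quadratic_field :: "int \<Rightarrow> complex set" where
  "quadratic_field D = {a + b * csqrt (of_int D) | a b. a \<in> \<rat> \<and> b \<in> \<rat>}"

definition fundamental_discriminant :: "int \<Rightarrow> bool" where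
  "fundamental_discriminant D \<longleftrightarrow>
     (D mod 4 = 1 \<and> squarefree D) \<or>
     (\<exists>m. D = 4 * m \<and> (m mod 4 = 2 \<or> m mod 4 = 3) \<and> squarefree m)"

text \<open>The Kronecker symbol \<open>(a/n)\<close>, for \<open>n \<ge> 1\<close> only.\<close>

definition kronecker_prime :: "int \<Rightarrow> nat \<Rightarrow> int" where
  "kronecker_prime a p =
     (if p = 2 then (if even a then 0 else if a mod 8 = 1 \<or> a mod 8 = 7 then 1 else -1)
      else Legendre a (int p))"

definition kronecker :: "int \<Rightarrow> nat \<Rightarrow> int" where
  "kronecker a n = (\<Prod>p\<in>prime_factors n. kronecker_prime a p ^ multiplicity p n)"

definition cm_point :: "int \<Rightarrow> complex" where
  "cm_point D =
     (if even D then csqrt (of_int D) / 2 else (1 + csqrt (of_int D)) / 2)"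

definition CS_period :: "int \<Rightarrow> real" where
  "CS_period D =
     1 / sqrt (2 * pi * \<bar>of_int D\<bar>) *
     (\<Prod>j = 1..nat \<bar>D\<bar> - 1. Gamma (real j / \<bar>of_int D\<bar>) powi kronecker D j)
       powr (1 / (2 * real (class_number (quadratic_field D))))"

definition divisor_sigma :: "nat \<Rightarrow> nat \<Rightarrow> nat" where
  "divisor_sigma k n = (\<Sum>d | d dvd n. d ^ k)"

definition nome :: "complex \<Rightarrow> complex" where
  "nome z = exp (2 * pi * \<i> * z)"

text \<open>All series and products below are shifted to start at \<open>n = 1\<close>.\<close>

definition Eis2 :: "complex \<Rightarrow> complex" where
  "Eis2 z = 1 - 24 * (\<Sum>n. of_nat (divisor_sigma 1 (Suc n)) * nome z ^ Suc n)"

definition Eis2_star :: "complex \<Rightarrow> complex" where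
  "Eis2_star z = Eis2 z - 3 / (pi * Im z)"

definition Eis4 :: "complex \<Rightarrow> complex" where
  "Eis4 z = 1 + 240 * (\<Sum>n. of_nat (divisor_sigma 3 (Suc n)) * nome z ^ Suc n)"

definition Eis6 :: "complex \<Rightarrow> complex" where
  "Eis6 z = 1 - 504 * (\<Sum>n. of_nat (divisor_sigma 5 (Suc n)) * nome z ^ Suc n)"

definition modular_Delta :: "complex \<Rightarrow> complex" where
  "modular_Delta z = nome z * (\<Prod>n. (1 - nome z ^ Suc n) ^ 24)"

definition moebius_action :: "complex^2^2 \<Rightarrow> complex \<Rightarrow> complex" where
  "moebius_action \<gamma> z = (\<gamma>$1$1 * z + \<gamma>$1$2) / (\<gamma>$2$1 * z + \<gamma>$2$2)"

definition slash12 :: "(complex \<Rightarrow> complex) \<Rightarrow> complex^2^2 \<Rightarrow> complex \<Rightarrow> complex" where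
  "slash12 f \<gamma> z =
     det \<gamma> ^ 6 * f (moebius_action \<gamma> z) * (\<gamma>$2$1 * z + \<gamma>$2$2) powi (-12)"

definition sigma_matrix :: "complex \<Rightarrow> complex^2^2" where
  "sigma_matrix z0 =
     mat (1 / (2 * \<i> * Im z0)) ** vector [vector [- cnj z0, z0], vector [-1, 1]]"

text \<open>For \<open>z0\<close> in the upper half-plane, \<open>slash12 f (sigma_matrix z0)\<close> only involves values
  of \<open>f\<close> on the upper half-plane when restricted to the unit disc.\<close>

definition taylor_coeff :: "complex \<Rightarrow> (complex \<Rightarrow> complex) \<Rightarrow> nat \<Rightarrow> complex" where
  "taylor_coeff z0 f n = fps_nth (fps_expansion (slash12 f (sigma_matrix z0)) 0) n"

end

theory Submission
  imports Defs "Jordan_Normal_Form.Char_Poly"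
begin

text \<open>In the disc coordinate \<open>w\<close> with \<open>\<tau> = (z - cnj z * w) / (1 - w)\<close>, the functions
  \<open>(1 - w) ^ (- k) * f \<tau>\<close> for \<open>f = E4, E6, \<Delta>\<close>, together with a corrected \<open>E2\<close> whose value at \<open>w = 0\<close> is
  \<open>Eis2_star z\<close>, satisfy Ramanujan's differential equations up to the factor \<open>- 4 * pi * Im z\<close>, so the Taylor
  coefficients are values at \<open>0\<close> of iterated derivatives. Choose the constant \<open>c = m1 / m2\<close> such that
  \<open>p = (E2 - c * E6 / E4) / 12\<close> vanishes at \<open>w = 0\<close>. Relative to this shift the derivatives of \<open>\<Delta>\<close> are
  polynomials in \<open>p\<close> whose constant terms are, up to scaling, \<open>\<Delta> * E4 powr (n / 2) * q n\<close> evaluated at the weight-zero function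
  \<open>E6 / E4 powr (3 / 2)\<close>, and the differential equations turn into the recursion for \<open>q n\<close>.
  Ramanujan's equations themselves reduce to convolution identities for divisor sums, which follow from
  a Euclidean substitution in the solutions of \<open>a x + b y = n\<close>.
  Integrality holds because \<open>q n\<close> is a polynomial with integral coefficients in \<open>k0 * d * (t + k3)\<close>.\<close>

section \<open>Algebraic integers\<close>

text \<open>The hypothesis makes \<open>v\<close> an eigenvector of the integer matrix
  \<open>c\<close> with eigenvalue \<open>x\<close>, so \<open>x\<close> is a root of its
  characteristic polynomial, which is monic with integer coefficients.\<close>

lemma algebraic_int_finite_module:
  fixes x :: "'a :: field_char_0" and v :: "nat \<Rightarrow> 'a" and c :: "nat \<Rightarrow> nat \<Rightarrow> int"
  assumes mult: "\<And>i. i < m \<Longrightarrow> x * v i = (\<Sum>j<m. of_int (c i j) * v j)"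
    and nz: "i0 < m" "v i0 \<noteq> 0"
  shows "algebraic_int x"
proof -
  define A where "A = Matrix.mat m m (\<lambda>(i, j). c i j)"
  define B where "B = (map_mat of_int A :: 'a Matrix.mat)"
  have A: "A \<in> carrier_mat m m" and B: "B \<in> carrier_mat m m"
    by (auto simp: A_def B_def)
  have "eigenvector B (Matrix.vec m v) x"
    unfolding eigenvector_def
  proof (intro conjI)
    show "Matrix.vec m v \<noteq> 0\<^sub>v (dim_row B)"
    proof
      assume "Matrix.vec m v = 0\<^sub>v (dim_row B)"
      then have "vec_index (Matrix.vec m v) i0 = vec_index (0\<^sub>v (dim_row B)) i0" by simp
      with nz B show False by auto
    qed
    show "B *\<^sub>v Matrix.vec m v = x \<cdot>\<^sub>v Matrix.vec m v"
      using B by (intro eq_vecI) (auto simp: A_def B_def scalar_prod_def mult lessThan_atLeast0)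
  qed (use B in auto)
  then have "poly (char_poly B) x = 0"
    using eigenvalue_root_char_poly[OF B] by (auto simp: eigenvalue_def)
  moreover have "char_poly B = map_poly of_int (char_poly A)"
    unfolding B_def by (rule of_int_hom.char_poly_hom[OF A])
  ultimately show ?thesis
    using degree_monic_char_poly[OF A] unfolding algebraic_int_altdef_ipoly by auto
qed

lemma algebraic_int_power_reduce:
  fixes x :: "'a :: field_char_0"
  assumes "algebraic_int x"
  obtains m and c :: "nat \<Rightarrow> int" where "m > 0" "x ^ m = (\<Sum>j<m. of_int (c j) * x ^ j)"
proof -
  obtain p where p: "poly (map_poly of_int p) x = 0" "lead_coeff p = 1"
    using assms unfolding algebraic_int_altdef_ipoly by auto
  have deg: "degree p \<noteq> 0"
  proof
    assume "degree p = 0"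
    then obtain a where "p = [:a:]" by (metis degree_eq_zeroE)
    with p show False by auto
  qed
  have "0 = (\<Sum>j\<le>degree p. of_int (Polynomial.coeff p j) * x ^ j)"
    using p(1) by (simp add: poly_altdef)
  also have "{..degree p} = insert (degree p) {..<degree p}" by auto
  finally have "x ^ degree p = (\<Sum>j<degree p. of_int (- Polynomial.coeff p j) * x ^ j)"
    using p(2) by (simp add: sum_negf add_eq_0_iff)
  with deg show ?thesis using that[of "degree p" "\<lambda>j. - Polynomial.coeff p j"] by blast
qed

text \<open>On an enumeration of \<open>V\<close>, multiplication by \<open>w\<close> is given by an
  integer matrix; the member 1 supplies the nonzero entry.\<close>

lemma algebraic_int_finite_span:
  fixes w :: "'a :: field_char_0" and V :: "'a set"
  assumes V: "finite V" "1 \<in> V"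
    and w: "\<And>v. v \<in> V \<Longrightarrow> w * v \<in> Modules.module.span (\<lambda>(c::int) v. of_int c * v) V"
  shows "algebraic_int w"
proof -
  interpret M: Modules.module "\<lambda>(c::int) (v::'a). of_int c * v"
    by unfold_locales (auto simp: algebra_simps)
  obtain f where f: "bij_betw f {..<card V} V"
    using ex_bij_betw_nat_finite[OF V(1)] by (auto simp: lessThan_atLeast0)
  have "\<exists>c. w * f i = (\<Sum>j<card V. of_int (c j) * f j)" if "i < card V" for i
  proof -
    have "f i \<in> V" using f that by (auto simp: bij_betw_def)
    from w[OF this] obtain u where "w * f i = (\<Sum>v\<in>V. of_int (u v) * v)"
      unfolding M.span_finite[OF V(1)] by auto
    also have "\<dots> = (\<Sum>j<card V. of_int (u (f j)) * f j)"
      by (rule sum.reindex_bij_betw[OF f, symmetric])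
    finally show ?thesis by (intro exI[of _ "\<lambda>j. u (f j)"])
  qed
  then obtain c where c: "\<And>i. i < card V \<Longrightarrow> w * f i = (\<Sum>j<card V. of_int (c i j) * f j)"
    by metis
  have "1 \<in> f ` {..<card V}" using f V(2) by (simp add: bij_betw_imp_surj_on)
  then obtain i0 where "i0 < card V" "f i0 = 1" by (metis imageE lessThan_iff)
  then show ?thesis using algebraic_int_finite_module[OF c] by simp
qed

text \<open>The condition on \<open>w\<close> speaks of an arbitrary additively closed
  \<open>M\<close> so that one proof serves sums and products. \<open>M\<close> becomes the integer
  span of the monomials whose exponents lie below the degrees of monic equations of \<open>x\<close>
  and \<open>y\<close>.\<close>

lemma algebraic_int_two_generators:
  fixes x y w :: "'a :: field_char_0"
  assumes xy: "algebraic_int x" "algebraic_int y"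
    and w: "\<And>M i j. (\<And>i j. x ^ i * y ^ j \<in> M) \<Longrightarrow> (\<And>a b. a \<in> M \<Longrightarrow> b \<in> M \<Longrightarrow> a + b \<in> M)
      \<Longrightarrow> w * (x ^ i * y ^ j) \<in> M"
  shows "algebraic_int w"
proof -
  interpret M: Modules.module "\<lambda>(c::int) (v::'a). of_int c * v"
    by unfold_locales (auto simp: algebra_simps)
  obtain m a where m: "m > 0" "x ^ m = (\<Sum>k<m. of_int (a k) * x ^ k)"
    using algebraic_int_power_reduce[OF xy(1)] .
  obtain n b where n: "n > 0" "y ^ n = (\<Sum>k<n. of_int (b k) * y ^ k)"
    using algebraic_int_power_reduce[OF xy(2)] .
  define V where "V = (\<lambda>(i, j). x ^ i * y ^ j) ` ({..<m} \<times> {..<n})"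
  have x_red: "x ^ i * y ^ j \<in> M.span V" if "j < n" for i j
  proof (induction i rule: less_induct)
    case (less i)
    show ?case
    proof (cases "i < m")
      case True
      with that show ?thesis by (intro M.span_base) (auto simp: V_def)
    next
      case False
      \<comment> \<open>Trading \<open>x ^ m\<close> for lower powers lowers the exponent, so the
        induction hypothesis covers every summand.\<close>
      then have "x ^ i = x ^ (i - m) * x ^ m" by (simp flip: power_add)
      then have "x ^ i * y ^ j = (\<Sum>k<m. of_int (a k) * (x ^ (i - m + k) * y ^ j))"
        by (simp add: m(2) sum_distrib_left sum_distrib_right power_add mult_ac)
      also have "\<dots> \<in> M.span V"
        using False by (intro M.span_sum M.span_scale less.IH) auto
      finally show ?thesis .
    qed
  qed
  have red: "x ^ i * y ^ j \<in> M.span V" for i j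
  proof (induction j rule: less_induct)
    case (less j)
    show ?case
    proof (cases "j < n")
      case False
      then have "y ^ j = y ^ (j - n) * y ^ n" by (simp flip: power_add)
      then have "x ^ i * y ^ j = (\<Sum>k<n. of_int (b k) * (x ^ i * y ^ (j - n + k)))"
        by (simp add: n(2) sum_distrib_left sum_distrib_right power_add mult_ac)
      also have "\<dots> \<in> M.span V"
        using False by (intro M.span_sum M.span_scale less.IH) auto
      finally show ?thesis .
    qed (rule x_red)
  qed
  show ?thesis
  proof (rule algebraic_int_finite_span[of V])
    have "x ^ 0 * y ^ 0 \<in> V" unfolding V_def using m(1) n(1) by (intro image_eqI[of _ _ "(0, 0)"]) auto
    then show "1 \<in> V" by simp
    show "w * v \<in> M.span V" if "v \<in> V" for v
      using that w[OF red M.span_add] unfolding V_def by auto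
  qed (simp add: V_def)
qed

lemma algebraic_int_add [intro]:
  fixes x y :: "'a :: field_char_0"
  assumes "algebraic_int x" "algebraic_int y"
  shows "algebraic_int (x + y)"
proof (rule algebraic_int_two_generators[OF assms])
  fix M and i j :: nat
  assume M: "\<And>i j. x ^ i * y ^ j \<in> M" "\<And>a b. a \<in> M \<Longrightarrow> b \<in> M \<Longrightarrow> a + b \<in> M"
  have "x ^ Suc i * y ^ j + x ^ i * y ^ Suc j \<in> M" by (intro M)
  then show "(x + y) * (x ^ i * y ^ j) \<in> M" by (simp add: algebra_simps)
qed

lemma algebraic_int_mult [intro]:
  fixes x y :: "'a :: field_char_0"
  assumes "algebraic_int x" "algebraic_int y"
  shows "algebraic_int (x * y)"
proof (rule algebraic_int_two_generators[OF assms])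
  fix M and i j :: nat
  assume "\<And>i j. x ^ i * y ^ j \<in> M"
  then have "x ^ Suc i * y ^ Suc j \<in> M" .
  then show "(x * y) * (x ^ i * y ^ j) \<in> M" by (simp add: algebra_simps)
qed

section \<open>Closure properties of the ring of integers\<close>

context
  fixes K :: "complex set"
  assumes K: "number_field K"
begin

lemma ring_of_integers_add:
  "x \<in> ring_of_integers K \<Longrightarrow> y \<in> ring_of_integers K \<Longrightarrow> x + y \<in> ring_of_integers K"
  and ring_of_integers_mult:
  "x \<in> ring_of_integers K \<Longrightarrow> y \<in> ring_of_integers K \<Longrightarrow> x * y \<in> ring_of_integers K"
  and ring_of_integers_1: "1 \<in> ring_of_integers K"
  and ring_of_integers_uminus: "x \<in> ring_of_integers K \<Longrightarrow> - x \<in> ring_of_integers K"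
proof -
  have sr: "subring K complex_ring"
    using K by (simp add: number_field_def subfield_def subdomain_def subcring_def)
  show "1 \<in> ring_of_integers K"
    using subringE(3)[OF sr] by (auto simp: ring_of_integers_def complex_ring_def)
  show "x \<in> ring_of_integers K \<Longrightarrow> y \<in> ring_of_integers K \<Longrightarrow> x + y \<in> ring_of_integers K"
    using subringE(7)[OF sr] by (auto simp: ring_of_integers_def complex_ring_def)
  show "x \<in> ring_of_integers K \<Longrightarrow> y \<in> ring_of_integers K \<Longrightarrow> x * y \<in> ring_of_integers K"
    using subringE(6)[OF sr] by (auto simp: ring_of_integers_def complex_ring_def)
  \<comment> \<open>The ring-theoretic inverse is a definite description in the additive monoid and
    has to be identified with the usual negation.\<close>
  have "\<ominus>\<^bsub>complex_ring\<^esub> x = - x"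
    unfolding a_inv_def m_inv_def complex_ring_def
    by (rule the_equality) (auto simp: eq_neg_iff_add_eq_0)
  then show "x \<in> ring_of_integers K \<Longrightarrow> - x \<in> ring_of_integers K"
    using subringE(5)[OF sr, of x] by (auto simp: ring_of_integers_def)
qed

lemma ring_of_integers_0: "0 \<in> ring_of_integers K"
  using ring_of_integers_add[OF ring_of_integers_1 ring_of_integers_uminus[OF ring_of_integers_1]] by simp

lemma ring_of_integers_of_nat: "of_nat n \<in> ring_of_integers K"
  by (induction n) (simp_all add: ring_of_integers_0 ring_of_integers_1 ring_of_integers_add)

lemma ring_of_integers_numeral: "numeral n \<in> ring_of_integers K"
  using ring_of_integers_of_nat[of "numeral n"] by simp

lemma ring_of_integers_power: "x \<in> ring_of_integers K \<Longrightarrow> x ^ n \<in> ring_of_integers K"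
  by (induction n) (simp_all add: ring_of_integers_1 ring_of_integers_mult)

lemma ring_of_integers_sum:
  "(\<And>i. i \<in> A \<Longrightarrow> f i \<in> ring_of_integers K) \<Longrightarrow> sum f A \<in> ring_of_integers K"
  by (induction A rule: infinite_finite_induct) (simp_all add: ring_of_integers_0 ring_of_integers_add)

end

section \<open>Convolution sums of divisor functions\<close>

text \<open>\<open>a\<close>, \<open>x\<close> and \<open>b\<close>, \<open>y\<close> are
  complementary divisors of two summands of \<open>n\<close>: the index tuples of a convolution of
  divisor sums.\<close>

definition bilinear_reps :: "nat \<Rightarrow> (nat \<times> nat \<times> nat \<times> nat) set" where
  "bilinear_reps n = {(a, b, x, y). a > 0 \<and> b > 0 \<and> x > 0 \<and> y > 0 \<and> a * x + b * y = n}"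

lemma finite_bilinear_reps: "finite (bilinear_reps n)"
proof (rule finite_subset)
  show "bilinear_reps n \<subseteq> {..n} \<times> {..n} \<times> {..n} \<times> {..n}"
  proof (clarsimp simp: bilinear_reps_def, intro conjI)
    fix a b x y :: nat
    assume p: "a > 0" "b > 0" "x > 0" "y > 0"
    have "a * 1 \<le> a * x" "b * 1 \<le> b * y" "1 * x \<le> a * x" "1 * y \<le> b * y"
      using p by (intro mult_le_mono; simp)+
    then show "a \<le> a * x + b * y" "b \<le> a * x + b * y" "x \<le> a * x + b * y" "y \<le> a * x + b * y"
      by linarith+
  qed
qed auto

lemma bilinear_reps_0 [simp]: "bilinear_reps 0 = {}"
  by (auto simp: bilinear_reps_def)

text \<open>Skoruppa's substitution: \<open>a x + b y = a (x + y) + (b - a) y\<close>.\<close>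

lemma sum_bilinear_reps_less:
  fixes f :: "nat \<Rightarrow> nat \<Rightarrow> 'a :: comm_monoid_add"
  shows "(\<Sum>(a, b, x, y) | (a, b, x, y) \<in> bilinear_reps n \<and> a < b. f a b) =
    (\<Sum>(a, b, x, y) | (a, b, x, y) \<in> bilinear_reps n \<and> y < x. f a (a + b))"
  by (rule sum.reindex_bij_witness[of _ "\<lambda>(a, b, x, y). (a, a + b, x - y, y)" "\<lambda>(a, b, x, y). (a, b - a, x + y, y)"])
     (auto simp: bilinear_reps_def algebra_simps dest!: less_imp_Suc_add)

lemma sum_bilinear_reps_swap:
  fixes f :: "nat \<Rightarrow> nat \<Rightarrow> nat \<Rightarrow> nat \<Rightarrow> 'a :: comm_monoid_add"
  shows "(\<Sum>(a, b, x, y)\<in>bilinear_reps n. f a b x y) = (\<Sum>(a, b, x, y)\<in>bilinear_reps n. f b a y x)"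
  by (rule sum.reindex_bij_witness[of _ "\<lambda>(a, b, x, y). (b, a, y, x)" "\<lambda>(a, b, x, y). (b, a, y, x)"])
     (auto simp: bilinear_reps_def algebra_simps)

text \<open>Split the first sum by comparing \<open>a\<close> with \<open>b\<close>, the second by
  comparing \<open>x\<close> with \<open>y\<close>. The substitution carries the part
  \<open>a < b\<close> to the part \<open>y < x\<close>, and \<open>sym\<close> and
  \<open>inv\<close> reduce the opposite parts to these, so only the two diagonals remain.\<close>

lemma sum_bilinear_reps_descent:
  fixes h :: "nat \<Rightarrow> nat \<Rightarrow> 'a :: ab_group_add"
  assumes sym: "\<And>a b. h a b = h b a" and inv: "\<And>a b. h a (a + b) = h b (a + b)"
  shows "(\<Sum>(a, b, x, y)\<in>bilinear_reps n. h a b - h a (a + b)) =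
    (\<Sum>(a, b, x, y)\<in>bilinear_reps n. if a = b then h a a else 0)
    - (\<Sum>(a, b, x, y)\<in>bilinear_reps n. if x = y then h a (a + b) else 0)"
proof -
  let ?S = "bilinear_reps n"
  have "(\<Sum>(a, b, x, y)\<in>?S. if a < b then h a b else 0) = (\<Sum>(a, b, x, y)\<in>?S. if y < x then h a (a + b) else 0)"
    using sum_bilinear_reps_less[of h n] finite_bilinear_reps[of n]
    by (simp add: sum.If_cases case_prod_unfold Int_def)
  moreover have "(\<Sum>(a, b, x, y)\<in>?S. if b < a then h a b else 0) = (\<Sum>(a, b, x, y)\<in>?S. if a < b then h a b else 0)"
    by (subst sum_bilinear_reps_swap[of "\<lambda>a b x y. if b < a then h a b else 0" n]) (auto intro!: sum.cong simp: sym)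
  moreover have "(\<Sum>(a, b, x, y)\<in>?S. if y < x then h a (a + b) else 0) = (\<Sum>(a, b, x, y)\<in>?S. if x < y then h a (a + b) else 0)"
    by (subst sum_bilinear_reps_swap[of "\<lambda>a b x y. if y < x then h a (a + b) else 0" n])
       (auto intro!: sum.cong simp: add.commute intro: inv[symmetric])
  moreover have "(\<Sum>(a, b, x, y)\<in>?S. h a b) = (\<Sum>(a, b, x, y)\<in>?S. if a < b then h a b else 0)
    + (\<Sum>(a, b, x, y)\<in>?S. if b < a then h a b else 0) + (\<Sum>(a, b, x, y)\<in>?S. if a = b then h a a else 0)"
    unfolding sum.distrib[symmetric] by (rule sum.cong) auto
  moreover have "(\<Sum>(a, b, x, y)\<in>?S. h a (a + b)) = (\<Sum>(a, b, x, y)\<in>?S. if y < x then h a (a + b) else 0)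
    + (\<Sum>(a, b, x, y)\<in>?S. if x < y then h a (a + b) else 0) + (\<Sum>(a, b, x, y)\<in>?S. if x = y then h a (a + b) else 0)"
    unfolding sum.distrib[symmetric] by (rule sum.cong) auto
  ultimately show ?thesis
    by (simp add: sum_subtractf case_prod_unfold)
qed

text \<open>For \<open>a = b = d\<close> the equation reads \<open>d * (x + y) = n\<close>, which
  leaves \<open>n div d - 1\<close> values of \<open>x\<close>.\<close>

lemma sum_bilinear_reps_diagonal:
  fixes f :: "nat \<Rightarrow> 'a :: comm_ring_1"
  shows "(\<Sum>(a, b, x, y)\<in>bilinear_reps n. if a = b then f a else 0) = (\<Sum>d | d dvd n. (of_nat (n div d) - 1) * f d)"
    (is "?L = ?R")
proof (cases "n = 0")
  case False
  have "?L = (\<Sum>(a, b, x, y) | (a, b, x, y) \<in> bilinear_reps n \<and> a = b. f a)"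
    using finite_bilinear_reps[of n] by (simp add: case_prod_unfold sum.inter_filter[symmetric])
  also have "\<dots> = (\<Sum>(d, x)\<in>(SIGMA d:{d. d dvd n}. {1..<n div d}). f d)"
    by (rule sum.reindex_bij_witness[of _ "\<lambda>(d, x). (d, d, x, n div d - x)" "\<lambda>(a, b, x, y). (a, x)"])
       (use False in \<open>auto simp: bilinear_reps_def distrib_left[symmetric] elim!: dvdE\<close>)
  also have "\<dots> = (\<Sum>d | d dvd n. \<Sum>x\<in>{1..<n div d}. f d)"
    using False by (intro sum.Sigma[symmetric]) auto
  also have "\<dots> = ?R"
    using False by (intro sum.cong refl) (auto simp: of_nat_diff elim!: dvdE)
  finally show ?thesis .
qed simp

text \<open>For \<open>x = y\<close> the equation reads \<open>(a + b) * x = n\<close>, so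
  \<open>d = a + b\<close> is a divisor of \<open>n\<close> and \<open>a\<close> runs below
  it.\<close>

lemma sum_bilinear_reps_codiagonal:
  fixes f :: "nat \<Rightarrow> nat \<Rightarrow> 'a :: comm_ring_1"
  shows "(\<Sum>(a, b, x, y)\<in>bilinear_reps n. if x = y then f a (a + b) else 0) = (\<Sum>d | d dvd n. \<Sum>a\<in>{1..<d}. f a d)"
    (is "?L = ?R")
proof (cases "n = 0")
  case False
  have "?L = (\<Sum>(a, b, x, y) | (a, b, x, y) \<in> bilinear_reps n \<and> x = y. f a (a + b))"
    using finite_bilinear_reps[of n] by (simp add: case_prod_unfold sum.inter_filter[symmetric])
  also have "\<dots> = (\<Sum>(d, a)\<in>(SIGMA d:{d. d dvd n}. {1..<d}). f a d)"
    by (rule sum.reindex_bij_witness[of _ "\<lambda>(d, a). (a, d - a, n div d, n div d)" "\<lambda>(a, b, x, y). (a + b, a)"])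
       (use False in \<open>auto simp: bilinear_reps_def distrib_right[symmetric] elim!: dvdE\<close>)
  also have "\<dots> = ?R"
    using False by (intro sum.Sigma[symmetric]) auto
  finally show ?thesis .
qed simp

lemma divisor_sigma_convolution:
  "(\<Sum>m\<le>n. of_nat (divisor_sigma i m) * of_nat (divisor_sigma j (n - m))) =
   (\<Sum>(a, b, x, y)\<in>bilinear_reps n. of_nat a ^ i * of_nat b ^ j :: 'a :: comm_semiring_1)"
proof -
  \<comment> \<open>Every number divides 0, and \<open>divisor_sigma k 0\<close> is 0 because the
    sum over an infinite set is 0 by default. The empty set gives the same value and keeps the index
    sets finite.\<close>
  define T where "T m = (if m = 0 then {} else {d :: nat. d dvd m})" for m
  have pos: "d dvd m \<Longrightarrow> 0 < m \<Longrightarrow> 0 < d" "d dvd m \<Longrightarrow> 0 < m \<Longrightarrow> 0 < m div d" for d m :: nat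
    by (auto elim!: dvdE)
  have fin: "finite (T m)" for m by (auto simp: T_def)
  have ds: "of_nat (divisor_sigma k m) = (\<Sum>d\<in>T m. of_nat d ^ k :: 'a)" for k m
    by (simp add: divisor_sigma_def T_def)
  have "(\<Sum>m\<le>n. of_nat (divisor_sigma i m) * of_nat (divisor_sigma j (n - m))) =
    (\<Sum>m\<le>n. \<Sum>(a, b)\<in>T m \<times> T (n - m). of_nat a ^ i * of_nat b ^ j :: 'a)"
    by (simp add: ds sum_product sum.cartesian_product)
  also have "\<dots> = (\<Sum>(m, a, b)\<in>(SIGMA m:{..n}. T m \<times> T (n - m)). of_nat a ^ i * of_nat b ^ j)"
    by (subst sum.Sigma) (auto simp: fin)
  also have "\<dots> = (\<Sum>(a, b, x, y)\<in>bilinear_reps n. of_nat a ^ i * of_nat b ^ j)"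
    by (rule sum.reindex_bij_witness[of _ "\<lambda>(a, b, x, y). (a * x, a, b)" "\<lambda>(m, a, b). (a, b, m div a, (n - m) div b)"])
       (auto simp: bilinear_reps_def T_def split: if_splits intro: pos)
  finally show ?thesis .
qed

lemma sum_telescope_interval:
  fixes F G :: "'a :: comm_ring_1 \<Rightarrow> 'a"
  assumes "d > 0" "\<And>x. G (x + 1) - G x = F x"
  shows "(\<Sum>a\<in>{1..<d}. F (of_nat a)) = G (of_nat d) - G 1"
  using assms(1)
proof (induction d rule: nat_induct_non_zero)
  case (Suc n)
  then have "{1..<Suc n} = insert n {1..<n}" by auto
  then show ?case using Suc assms(2)[of "of_nat n"] by (simp add: add.commute algebra_simps)
qed simp

section \<open>Convolution identities from explicit invariant polynomials\<close>

context
  fixes n :: nat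
begin

private abbreviation \<sigma> :: "nat \<Rightarrow> complex" where "\<sigma> k \<equiv> of_nat (divisor_sigma k n)"

private abbreviation conv :: "nat \<Rightarrow> nat \<Rightarrow> complex" where
  "conv i j \<equiv> (\<Sum>m\<le>n. of_nat (divisor_sigma i m) * of_nat (divisor_sigma j (n - m)))"

private abbreviation reps_sum :: "(complex \<Rightarrow> complex \<Rightarrow> complex) \<Rightarrow> complex" where
  "reps_sum f \<equiv> (\<Sum>(a, b, x, y)\<in>bilinear_reps n. f (of_nat a) (of_nat b))"

private lemma conv_eq: "conv i j = reps_sum (\<lambda>a b. a ^ i * b ^ j)"
  by (rule divisor_sigma_convolution)

private lemma conv_commute: "conv i j = conv j i"
  unfolding conv_eq by (subst sum_bilinear_reps_swap) (simp add: mult.commute)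

text \<open>\<open>G\<close> is a discrete antiderivative of \<open>h\<close> in its first argument,
  so the codiagonal sums telescope. The condition \<open>inv\<close> says that \<open>h\<close> is
  unchanged when \<open>a\<close> becomes \<open>d - a\<close> for a fixed second argument
  \<open>d\<close>.\<close>

private lemma descent:
  fixes h :: "complex \<Rightarrow> complex \<Rightarrow> complex" and G :: "complex \<Rightarrow> complex \<Rightarrow> complex"
  assumes sym: "\<And>a b. h a b = h b a" and inv: "\<And>a b. h a (a + b) = h b (a + b)"
    and G: "\<And>d x. G d (x + 1) - G d x = h x d"
  shows "reps_sum (\<lambda>a b. h a b - h a (a + b)) =
    (\<Sum>d | d dvd n. (of_nat (n div d) - 1) * h (of_nat d) (of_nat d) - (G (of_nat d) (of_nat d) - G (of_nat d) 1))"
proof (cases "n = 0")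
  case False
  have inv': "h (of_nat a) (of_nat (a + b)) = h (of_nat b) (of_nat (a + b))" for a b
    using inv by simp
  have "reps_sum (\<lambda>a b. h a b - h a (a + b)) =
    (\<Sum>d | d dvd n. (of_nat (n div d) - 1) * h (of_nat d) (of_nat d)) -
    (\<Sum>d | d dvd n. \<Sum>a\<in>{1..<d}. h (of_nat a) (of_nat d))"
    using sum_bilinear_reps_descent[of "\<lambda>a b. h (of_nat a) (of_nat b)" n, OF sym inv']
      sum_bilinear_reps_diagonal[of "\<lambda>a. h (of_nat a) (of_nat a)" n]
      sum_bilinear_reps_codiagonal[of "\<lambda>a b. h (of_nat a) (of_nat b)" n] by simp
  also have "(\<Sum>d | d dvd n. \<Sum>a\<in>{1..<d}. h (of_nat a) (of_nat d)) =
    (\<Sum>d | d dvd n. G (of_nat d) (of_nat d) - G (of_nat d) 1)"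
    using False
    by (intro sum.cong refl, intro sum_telescope_interval[of _ "G (of_nat d)" "\<lambda>x. h x (of_nat d)" for d] G)
       (auto intro: Nat.gr0I)
  finally show ?thesis by (simp add: sum_subtractf case_prod_unfold)
qed simp

private lemma sigma_eq: "\<sigma> k = (\<Sum>d | d dvd n. of_nat d ^ k)"
  by (simp add: divisor_sigma_def)

private lemma n_sigma_eq: "of_nat n * \<sigma> k = (\<Sum>d | d dvd n. of_nat (n div d) * of_nat d ^ Suc k :: complex)"
  unfolding sigma_eq sum_distrib_left
  by (intro sum.cong refl) (auto elim!: dvdE)

lemma divisor_sigma_conv_1_1: "12 * conv 1 1 = 5 * \<sigma> 3 - (6 * of_nat n - 1) * \<sigma> 1"
proof -
  \<comment> \<open>This form is invariant under the swap and the reflection; passing from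
    \<open>b\<close> to \<open>a + b\<close> flips the sign of its mixed term and changes nothing
    else.\<close>
  define h :: "complex \<Rightarrow> complex \<Rightarrow> complex" where "h a b = a^2 - a * b + b^2" for a b
  \<comment> \<open>The power sums of exponents 2, 1 and 0 over the integers below \<open>x\<close>,
    weighted as in \<open>h x d\<close>.\<close>
  define G :: "complex \<Rightarrow> complex \<Rightarrow> complex" where
    "G d x = (2*x^3 - 3*x^2 + x) / 6 - d * (x^2 - x) / 2 + d^2 * x" for d x
  have G: "G d (x + 1) - G d x = h x d" for d x
    by (simp add: h_def G_def field_simps, Groebner_Basis.algebra)
  have "h a b - h a (a + b) = -2 * (a ^ 1 * b ^ 1)" for a b
    unfolding h_def by (simp, Groebner_Basis.algebra)
  then have "-2 * conv 1 1 = reps_sum (\<lambda>a b. h a b - h a (a + b))"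
    unfolding conv_eq sum_distrib_left sum_subtractf[symmetric] case_prod_unfold
    by (intro sum.cong refl) (simp only:)
  also have "reps_sum (\<lambda>a b. h a b - h a (a + b)) = (\<Sum>d | d dvd n. (of_nat (n div d) - 1) * h (of_nat d) (of_nat d)
      - (G (of_nat d) (of_nat d) - G (of_nat d) 1))"
    by (rule descent[where h = h and G = G, OF _ _ G]) (unfold h_def, Groebner_Basis.algebra+)
  also have "\<dots> = (\<Sum>d | d dvd n. of_nat (n div d) * of_nat d ^ 2 - 5/6 * of_nat d ^ 3 - 1/6 * of_nat d ^ 1)"
  proof (intro sum.cong refl)
    have hd: "h d d = d ^ 2" and G1: "G d 1 = d ^ 2" for d
      by (simp_all add: h_def G_def eval_nat_numeral)
    have "(N - 1) * h d d - (G d d - G d 1) = N * d ^ 2 - 5/6 * d ^ 3 - 1/6 * d ^ 1" for N d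
      unfolding hd G1 unfolding G_def by (simp add: field_simps; Groebner_Basis.algebra)
    then show "(of_nat (n div d) - 1) * h (of_nat d) (of_nat d)
      - (G (of_nat d) (of_nat d) - G (of_nat d) 1) = of_nat (n div d) * of_nat d ^ 2 - 5/6 * of_nat d ^ 3 - 1/6 * of_nat d ^ 1" for d .
  qed
  also have "\<dots> = of_nat n * \<sigma> 1 - 5/6 * \<sigma> 3 - 1/6 * \<sigma> 1"
    unfolding n_sigma_eq unfolding sigma_eq sum_subtractf sum.distrib sum_distrib_left by (simp add: power2_eq_square)
  finally show ?thesis by Groebner_Basis.algebra
qed

lemma divisor_sigma_conv_1_3: "240 * conv 1 3 = 21 * \<sigma> 5 - (30 * of_nat n - 10) * \<sigma> 3 - \<sigma> 1"
proof -
  \<comment> \<open>The square of the same quadratic form; its difference contains only odd powers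
    of \<open>a\<close> and \<open>b\<close>.\<close>
  define h :: "complex \<Rightarrow> complex \<Rightarrow> complex" where "h a b = (a^2 - a * b + b^2)^2" for a b
  define G :: "complex \<Rightarrow> complex \<Rightarrow> complex" where
    "G d x = (6*x^5 - 15*x^4 + 10*x^3 - x) / 30 - d * (x^4 - 2*x^3 + x^2) / 2
       + d^2 * (2*x^3 - 3*x^2 + x) / 2 - d^3 * (x^2 - x) + d^4 * x" for d x
  have G: "G d (x + 1) - G d x = h x d" for d x
    by (simp add: h_def G_def field_simps, Groebner_Basis.algebra)
  have "h a b - h a (a + b) = -4 * (a ^ 1 * b ^ 3) - 4 * (a ^ 3 * b ^ 1)" for a b
    unfolding h_def by (simp, Groebner_Basis.algebra)
  then have "-4 * conv 1 3 - 4 * conv 3 1 = reps_sum (\<lambda>a b. h a b - h a (a + b))"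
    unfolding conv_eq sum_distrib_left sum_subtractf[symmetric] case_prod_unfold
    by (intro sum.cong refl) (simp only:)
  also have "reps_sum (\<lambda>a b. h a b - h a (a + b)) = (\<Sum>d | d dvd n. (of_nat (n div d) - 1) * h (of_nat d) (of_nat d)
      - (G (of_nat d) (of_nat d) - G (of_nat d) 1))"
    by (rule descent[where h = h and G = G, OF _ _ G]) (unfold h_def, Groebner_Basis.algebra+)
  also have "\<dots> = (\<Sum>d | d dvd n. of_nat (n div d) * of_nat d ^ 4 - 7/10 * of_nat d ^ 5 - 1/3 * of_nat d ^ 3 + 1/30 * of_nat d ^ 1)"
  proof (intro sum.cong refl)
    have hd: "h d d = d ^ 4" and G1: "G d 1 = d ^ 4" for d
      by (simp_all add: h_def G_def eval_nat_numeral)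
    have "(N - 1) * h d d - (G d d - G d 1) = N * d ^ 4 - 7/10 * d ^ 5 - 1/3 * d ^ 3 + 1/30 * d ^ 1" for N d
      unfolding hd G1 unfolding G_def by (simp add: field_simps; Groebner_Basis.algebra)
    then show "(of_nat (n div d) - 1) * h (of_nat d) (of_nat d)
      - (G (of_nat d) (of_nat d) - G (of_nat d) 1) = of_nat (n div d) * of_nat d ^ 4 - 7/10 * of_nat d ^ 5 - 1/3 * of_nat d ^ 3 + 1/30 * of_nat d ^ 1" for d .
  qed
  also have "\<dots> = of_nat n * \<sigma> 3 - 7/10 * \<sigma> 5 - 1/3 * \<sigma> 3 + 1/30 * \<sigma> 1"
    unfolding n_sigma_eq unfolding sigma_eq sum_subtractf sum.distrib sum_distrib_left by (simp add: power2_eq_square)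
  finally show ?thesis using conv_commute[of 3 1] by Groebner_Basis.algebra
qed

lemma divisor_sigma_conv_3_3: "120 * conv 3 3 = \<sigma> 7 - \<sigma> 3"
proof -
  \<comment> \<open>\<open>a * b * (a - b)\<close> changes at most its sign under both symmetries,
    so its square is invariant; it isolates \<open>conv 3 3\<close>.\<close>
  define h :: "complex \<Rightarrow> complex \<Rightarrow> complex" where "h a b = (a * b * (a - b))^2" for a b
  define G :: "complex \<Rightarrow> complex \<Rightarrow> complex" where
    "G d x = d^2 * (6*x^5 - 15*x^4 + 10*x^3 - x) / 30 - d^3 * (x^4 - 2*x^3 + x^2) / 2
       + d^4 * (2*x^3 - 3*x^2 + x) / 6" for d x
  have G: "G d (x + 1) - G d x = h x d" for d x
    by (simp add: h_def G_def field_simps, Groebner_Basis.algebra)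
  have "h a b - h a (a + b) = -4 * (a ^ 3 * b ^ 3)" for a b
    unfolding h_def by (simp, Groebner_Basis.algebra)
  then have "-4 * conv 3 3 = reps_sum (\<lambda>a b. h a b - h a (a + b))"
    unfolding conv_eq sum_distrib_left sum_subtractf[symmetric] case_prod_unfold
    by (intro sum.cong refl) (simp only:)
  also have "reps_sum (\<lambda>a b. h a b - h a (a + b)) = (\<Sum>d | d dvd n. (of_nat (n div d) - 1) * h (of_nat d) (of_nat d)
      - (G (of_nat d) (of_nat d) - G (of_nat d) 1))"
    by (rule descent[where h = h and G = G, OF _ _ G]) (unfold h_def, Groebner_Basis.algebra+)
  also have "\<dots> = (\<Sum>d | d dvd n. 1/30 * of_nat d ^ 3 - 1/30 * of_nat d ^ 7)"
  proof (intro sum.cong refl)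
    have hd: "h d d = 0" and G1: "G d 1 = 0" for d
      by (simp_all add: h_def G_def eval_nat_numeral)
    have "(N - 1) * h d d - (G d d - G d 1) = 1/30 * d ^ 3 - 1/30 * d ^ 7" for N d
      unfolding hd G1 unfolding G_def by (simp add: field_simps; Groebner_Basis.algebra)
    then show "(of_nat (n div d) - 1) * h (of_nat d) (of_nat d)
      - (G (of_nat d) (of_nat d) - G (of_nat d) 1) = 1/30 * of_nat d ^ 3 - 1/30 * of_nat d ^ 7" for d .
  qed
  also have "\<dots> = 1/30 * \<sigma> 3 - 1/30 * \<sigma> 7"
    unfolding n_sigma_eq unfolding sigma_eq sum_subtractf sum.distrib sum_distrib_left by (simp add: power2_eq_square)
  finally show ?thesis by Groebner_Basis.algebra
qed

lemma divisor_sigma_conv_1_5: "504 * conv 1 5 = 20 * \<sigma> 7 - (42 * of_nat n - 21) * \<sigma> 5 + \<sigma> 1"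
proof -
  \<comment> \<open>The cube of the quadratic form also produces \<open>conv 3 3\<close>, which the
    preceding identity removes at the end.\<close>
  define h :: "complex \<Rightarrow> complex \<Rightarrow> complex" where "h a b = (a^2 - a * b + b^2)^3" for a b
  define G :: "complex \<Rightarrow> complex \<Rightarrow> complex" where
    "G d x = (6*x^7 - 21*x^6 + 21*x^5 - 7*x^3 + x) / 42 - d * (2*x^6 - 6*x^5 + 5*x^4 - x^2) / 4
       + d^2 * (6*x^5 - 15*x^4 + 10*x^3 - x) / 5 - 7 * d^3 * (x^4 - 2*x^3 + x^2) / 4
       + d^4 * (2*x^3 - 3*x^2 + x) - 3 * d^5 * (x^2 - x) / 2 + d^6 * x" for d x
  have G: "G d (x + 1) - G d x = h x d" for d x
    by (simp add: h_def G_def field_simps, Groebner_Basis.algebra)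
  have "h a b - h a (a + b) = -6 * (a ^ 1 * b ^ 5) - 6 * (a ^ 5 * b ^ 1) - 14 * (a ^ 3 * b ^ 3)" for a b
    unfolding h_def by (simp, Groebner_Basis.algebra)
  then have "-6 * conv 1 5 - 6 * conv 5 1 - 14 * conv 3 3 = reps_sum (\<lambda>a b. h a b - h a (a + b))"
    unfolding conv_eq sum_distrib_left sum_subtractf[symmetric] case_prod_unfold
    by (intro sum.cong refl) (simp only:)
  also have "reps_sum (\<lambda>a b. h a b - h a (a + b)) = (\<Sum>d | d dvd n. (of_nat (n div d) - 1) * h (of_nat d) (of_nat d)
      - (G (of_nat d) (of_nat d) - G (of_nat d) 1))"
    by (rule descent[where h = h and G = G, OF _ _ G]) (unfold h_def, Groebner_Basis.algebra+)
  also have "\<dots> = (\<Sum>d | d dvd n. of_nat (n div d) * of_nat d ^ 6 - 83/140 * of_nat d ^ 7 - 1/2 * of_nat d ^ 5 + 7/60 * of_nat d ^ 3 - 1/42 * of_nat d ^ 1)"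
  proof (intro sum.cong refl)
    have hd: "h d d = d ^ 6" and G1: "G d 1 = d ^ 6" for d
      by (simp_all add: h_def G_def eval_nat_numeral)
    have "(N - 1) * h d d - (G d d - G d 1) = N * d ^ 6 - 83/140 * d ^ 7 - 1/2 * d ^ 5 + 7/60 * d ^ 3 - 1/42 * d ^ 1" for N d
      unfolding hd G1 unfolding G_def by (simp add: field_simps; Groebner_Basis.algebra)
    then show "(of_nat (n div d) - 1) * h (of_nat d) (of_nat d)
      - (G (of_nat d) (of_nat d) - G (of_nat d) 1) = of_nat (n div d) * of_nat d ^ 6 - 83/140 * of_nat d ^ 7 - 1/2 * of_nat d ^ 5 + 7/60 * of_nat d ^ 3 - 1/42 * of_nat d ^ 1" for d .
  qed
  also have "\<dots> = of_nat n * \<sigma> 5 - 83/140 * \<sigma> 7 - 1/2 * \<sigma> 5 + 7/60 * \<sigma> 3 - 1/42 * \<sigma> 1"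
    unfolding n_sigma_eq unfolding sigma_eq sum_subtractf sum.distrib sum_distrib_left by (simp add: power2_eq_square)
  finally show ?thesis using conv_commute[of 5 1] divisor_sigma_conv_3_3 by Groebner_Basis.algebra
qed

end

section \<open>Ramanujan's differential equations\<close>

definition sigma_fps :: "nat \<Rightarrow> complex fps" where
  "sigma_fps k = Abs_fps (\<lambda>n. of_nat (divisor_sigma k n))"

definition qderiv :: "complex fps \<Rightarrow> complex fps" where
  "qderiv f = fps_X * fps_deriv f"

lemma divisor_sigma_0 [simp]: "divisor_sigma k 0 = 0"
  by (simp add: divisor_sigma_def)

lemma qderiv_nth: "fps_nth (qderiv f) n = of_nat n * fps_nth f n"
  by (cases n) (simp_all add: qderiv_def)

lemma sigma_fps_mult_nth:
  "fps_nth (sigma_fps i * sigma_fps j) n =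
   (\<Sum>m\<le>n. of_nat (divisor_sigma i m) * of_nat (divisor_sigma j (n - m)))"
  by (simp add: fps_mult_nth sigma_fps_def atMost_atLeast0)

lemma sigma_fps_mult:
  "12 * (sigma_fps 1 * sigma_fps 1) = 5 * sigma_fps 3 - 6 * qderiv (sigma_fps 1) + sigma_fps 1"
  "240 * (sigma_fps 1 * sigma_fps 3) = 21 * sigma_fps 5 - 30 * qderiv (sigma_fps 3) + 10 * sigma_fps 3 - sigma_fps 1"
  "120 * (sigma_fps 3 * sigma_fps 3) = sigma_fps 7 - sigma_fps 3"
  "504 * (sigma_fps 1 * sigma_fps 5) = 20 * sigma_fps 7 - 42 * qderiv (sigma_fps 5) + 21 * sigma_fps 5 + sigma_fps 1"
  by (rule fps_ext; simp only: fps_mult_numeral_left fps_add_nth fps_sub_nth sigma_fps_mult_nth qderiv_nth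
        divisor_sigma_conv_1_1 divisor_sigma_conv_1_3 divisor_sigma_conv_3_3 divisor_sigma_conv_1_5;
      simp add: sigma_fps_def algebra_simps)+

definition "E2_fps = 1 - 24 * sigma_fps 1"
definition "E4_fps = 1 + 240 * sigma_fps 3"
definition "E6_fps = 1 - 504 * sigma_fps 5"

lemma qderiv_simps:
  "qderiv (1 - numeral m * f) = - numeral m * qderiv f" "qderiv (1 + numeral m * f) = numeral m * qderiv f"
  by (simp_all add: qderiv_def algebra_simps)

text \<open>Linear combinations of the four convolution identities; in the third equation
  \<open>sigma_fps 7\<close> is eliminated between the two identities that contain it.\<close>

lemma ramanujan_fps:
  "12 * qderiv E2_fps = E2_fps ^ 2 - E4_fps"
  "3 * qderiv E4_fps = E2_fps * E4_fps - E6_fps"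
  "2 * qderiv E6_fps = E2_fps * E6_fps - E4_fps ^ 2"
  using sigma_fps_mult unfolding E2_fps_def E4_fps_def E6_fps_def qderiv_simps
  by Groebner_Basis.algebra+

section \<open>Convergence of the q-series and differentiation in the upper half-plane\<close>

lemma divisor_sigma_le: "divisor_sigma k n \<le> n ^ Suc k"
proof (cases "n = 0")
  case False
  have "divisor_sigma k n \<le> (\<Sum>d\<in>{1..n}. n ^ k)"
    unfolding divisor_sigma_def
    by (rule order_trans[OF sum_mono sum_mono2]) (use False in \<open>auto intro: power_mono dvd_imp_le Nat.gr0I simp: Suc_le_eq\<close>)
  then show ?thesis by simp
qed simp

lemma conv_radius_of_nat_power: "conv_radius (\<lambda>n. of_nat n ^ k :: complex) = 1"
proof (rule conv_radius_ratio_limit)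
  show "(\<lambda>n. norm (of_nat n ^ k :: complex) / norm (of_nat (Suc n) ^ k :: complex)) \<longlonglongrightarrow> 1"
    unfolding norm_power norm_of_nat power_divide[symmetric]
    using tendsto_power[OF LIMSEQ_n_over_Suc_n, of k] by simp
  show "\<forall>\<^sub>F n in sequentially. of_nat n ^ k \<noteq> (0 :: complex)"
    using eventually_gt_at_top[of 0] by eventually_elim auto
qed (simp add: one_ereal_def)

lemma sigma_fps_conv_radius: "fps_conv_radius (sigma_fps k) \<ge> 1"
  unfolding fps_conv_radius_def
proof (rule conv_radius_geI_ex')
  fix r :: real assume r: "0 < r" "ereal r < 1"
  have "summable (\<lambda>n. norm (of_nat n ^ Suc k * of_real r ^ n :: complex))"
    using r by (intro abs_summable_in_conv_radius, subst conv_radius_of_nat_power) (simp add: one_ereal_def)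
  then show "summable (\<lambda>n. fps_nth (sigma_fps k) n * of_real r ^ n)"
  proof (rule summable_comparison_test')
    fix n :: nat assume "n \<ge> 0"
    have "real (divisor_sigma k n) \<le> real n ^ Suc k"
      using divisor_sigma_le[of k n] by (metis of_nat_le_iff of_nat_power)
    then show "norm (fps_nth (sigma_fps k) n * of_real r ^ n) \<le> norm (of_nat n ^ Suc k * of_real r ^ n :: complex)"
      using r by (simp add: sigma_fps_def norm_mult norm_power mult_right_mono)
  qed
qed

lemma eval_sigma_fps:
  assumes "norm x < 1"
  shows "eval_fps (sigma_fps k) x = (\<Sum>n. of_nat (divisor_sigma k (Suc n)) * x ^ Suc n)"
proof -
  have "ereal (norm x) < fps_conv_radius (sigma_fps k)"
    using assms sigma_fps_conv_radius[of k] by (metis ereal_less(3) less_le_trans)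
  from summable_fps[OF this] have "summable (\<lambda>n. of_nat (divisor_sigma k n) * x ^ n)"
    by (simp add: sigma_fps_def)
  from suminf_split_head[OF this] show ?thesis
    by (simp add: eval_fps_def sigma_fps_def)
qed

lemma numeral_sigma_fps_conv_radius: "fps_conv_radius (numeral m * sigma_fps k) \<ge> 1"
  by (rule order_trans[OF _ fps_conv_radius_mult]) (simp add: sigma_fps_conv_radius)

lemma E_fps_conv_radius:
  "fps_conv_radius E2_fps \<ge> 1" "fps_conv_radius E4_fps \<ge> 1" "fps_conv_radius E6_fps \<ge> 1"
  unfolding E2_fps_def E4_fps_def E6_fps_def
  by (rule order_trans[OF _ fps_conv_radius_diff] order_trans[OF _ fps_conv_radius_add];
      simp add: numeral_sigma_fps_conv_radius)+

lemma qderiv_conv_radius: "fps_conv_radius f \<le> fps_conv_radius (qderiv f)"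
  unfolding qderiv_def using fps_conv_radius_deriv[of f]
  by (intro order_trans[OF _ fps_conv_radius_mult]) simp

lemma norm_nome: "norm (nome z) = exp (- 2 * pi * Im z)"
  by (simp add: nome_def norm_exp_eq_Re)

lemma norm_nome_less_1: "Im z > 0 \<Longrightarrow> norm (nome z) < 1"
  by (simp add: norm_nome)

lemma Eis_eq_eval_fps:
  assumes "Im z > 0"
  shows "Eis2 z = eval_fps E2_fps (nome z)" "Eis4 z = eval_fps E4_fps (nome z)" "Eis6 z = eval_fps E6_fps (nome z)"
proof -
  have q: "norm (nome z) < 1" by (rule norm_nome_less_1[OF assms])
  then have q': "ereal (norm (nome z)) < 1" by (simp add: one_ereal_def)
  have num: "fps_conv_radius (numeral m * sigma_fps k) > norm (nome z)" "fps_conv_radius (sigma_fps k) > norm (nome z)" for m k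
    by (rule less_le_trans[OF q'], rule numeral_sigma_fps_conv_radius sigma_fps_conv_radius)+
  show "Eis2 z = eval_fps E2_fps (nome z)" "Eis4 z = eval_fps E4_fps (nome z)" "Eis6 z = eval_fps E6_fps (nome z)"
    unfolding Eis2_def Eis4_def Eis6_def E2_fps_def E4_fps_def E6_fps_def
    using num by (simp_all add: eval_fps_diff eval_fps_add eval_fps_mult eval_sigma_fps[OF q])
qed

lemma nome_deriv [derivative_intros]:
  "(nome has_field_derivative 2 * pi * \<i> * nome z) (at z within A)"
  unfolding nome_def by (auto intro!: derivative_eq_intros)

lemma eval_fps_nome_deriv:
  assumes "Im z > 0" and f: "fps_conv_radius f \<ge> 1"
  shows "((\<lambda>z. eval_fps f (nome z)) has_field_derivative 2 * pi * \<i> * eval_fps (qderiv f) (nome z)) (at z)"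
proof -
  have q: "ereal (norm (nome z)) < fps_conv_radius f"
    using norm_nome_less_1[OF assms(1)] f by (metis ereal_less(3) less_le_trans)
  have "eval_fps (qderiv f) (nome z) = nome z * eval_fps (fps_deriv f) (nome z)"
    unfolding qderiv_def using q fps_conv_radius_deriv[of f] by (subst eval_fps_mult) auto
  then show ?thesis
    using DERIV_chain2[OF has_field_derivative_eval_fps[OF q] nome_deriv] by (simp add: mult_ac)
qed

theorem ramanujan_Eis:
  assumes z: "Im z > 0"
  shows "(Eis2 has_field_derivative 2 * pi * \<i> * ((Eis2 z ^ 2 - Eis4 z) / 12)) (at z)"
    and "(Eis4 has_field_derivative 2 * pi * \<i> * ((Eis2 z * Eis4 z - Eis6 z) / 3)) (at z)"
    and "(Eis6 has_field_derivative 2 * pi * \<i> * ((Eis2 z * Eis6 z - Eis4 z ^ 2) / 2)) (at z)"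
proof -
  let ?q = "nome z"
  have "1 > ereal (norm ?q)"
    using norm_nome_less_1[OF z] by (simp add: one_ereal_def)
  note rad = less_le_trans[OF this]
  have rads: "ereal (norm ?q) < fps_conv_radius E2_fps" "ereal (norm ?q) < fps_conv_radius E4_fps"
    "ereal (norm ?q) < fps_conv_radius E6_fps"
    by (intro rad E_fps_conv_radius)+
  then have rads': "ereal (norm ?q) < fps_conv_radius (qderiv E2_fps)" "ereal (norm ?q) < fps_conv_radius (qderiv E4_fps)"
    "ereal (norm ?q) < fps_conv_radius (qderiv E6_fps)"
    by (auto intro: less_le_trans[OF _ qderiv_conv_radius])
  have rads'': "ereal (norm ?q) < fps_conv_radius (E2_fps ^ 2)" "ereal (norm ?q) < fps_conv_radius (E4_fps ^ 2)"
    "ereal (norm ?q) < fps_conv_radius (E2_fps * E4_fps)" "ereal (norm ?q) < fps_conv_radius (E2_fps * E6_fps)"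
    using rads by (auto intro!: less_le_trans[OF _ fps_conv_radius_power] less_le_trans[OF _ fps_conv_radius_mult])
  have eval: "12 * eval_fps (qderiv E2_fps) ?q = Eis2 z ^ 2 - Eis4 z"
    "3 * eval_fps (qderiv E4_fps) ?q = Eis2 z * Eis4 z - Eis6 z"
    "2 * eval_fps (qderiv E6_fps) ?q = Eis2 z * Eis6 z - Eis4 z ^ 2"
    using arg_cong[OF ramanujan_fps(1), of "\<lambda>f. eval_fps f ?q"] arg_cong[OF ramanujan_fps(2), of "\<lambda>f. eval_fps f ?q"]
      arg_cong[OF ramanujan_fps(3), of "\<lambda>f. eval_fps f ?q"] rads rads' rads''
    by (simp_all add: eval_fps_mult eval_fps_diff eval_fps_power Eis_eq_eval_fps[OF z])
  \<comment> \<open>The identification with the power series holds for \<open>Im z > 0\<close>; this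
    set is open, which is enough for derivatives.\<close>
  have transform: "(h has_field_derivative D) (at z)"
    if "((\<lambda>z. eval_fps f (nome z)) has_field_derivative D) (at z)" "\<And>z. Im z > 0 \<Longrightarrow> h z = eval_fps f (nome z)" for h f D
    using that z by (intro has_field_derivative_transform_within_open[OF that(1) open_halfspace_Im_gt[of 0]]) auto
  note der = eval_fps_nome_deriv[OF z]
  show "(Eis2 has_field_derivative 2 * pi * \<i> * ((Eis2 z ^ 2 - Eis4 z) / 12)) (at z)"
    unfolding eval(1)[symmetric] using transform[OF der[OF E_fps_conv_radius(1)] Eis_eq_eval_fps(1)] by simp
  show "(Eis4 has_field_derivative 2 * pi * \<i> * ((Eis2 z * Eis4 z - Eis6 z) / 3)) (at z)"
    unfolding eval(2)[symmetric] using transform[OF der[OF E_fps_conv_radius(2)] Eis_eq_eval_fps(2)] by simp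
  show "(Eis6 has_field_derivative 2 * pi * \<i> * ((Eis2 z * Eis6 z - Eis4 z ^ 2) / 2)) (at z)"
    unfolding eval(3)[symmetric] using transform[OF der[OF E_fps_conv_radius(3)] Eis_eq_eval_fps(3)] by simp
qed

section \<open>The Lambert series and the logarithmic derivative of Delta\<close>

lemma lambert_series_sigma:
  fixes x :: complex
  assumes x: "norm x < 1"
  shows "(\<lambda>d. of_nat (Suc d) * x ^ Suc d / (1 - x ^ Suc d)) sums eval_fps (sigma_fps 1) x"
proof -
  let ?S = "eval_fps (sigma_fps 1) x"
  define g where "g N = of_nat (divisor_sigma 1 N) * x ^ N" for N
  have "ereal (norm x) < conv_radius (fps_nth (sigma_fps 1))"
    using x sigma_fps_conv_radius[of 1] unfolding fps_conv_radius_def by (metis ereal_less(3) less_le_trans)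
  from abs_summable_in_conv_radius[OF this] have g_summable: "summable (\<lambda>N. norm (g N))"
    by (simp add: g_def sigma_fps_def)
  have "(g has_sum ?S) UNIV"
    using norm_summable_imp_has_sum[OF g_summable summable_sums[OF summable_norm_cancel[OF g_summable]]]
    by (simp add: eval_fps_def sigma_fps_def g_def[abs_def])
  then have g_sum: "(g has_sum ?S) {1..}"
    by (rule has_sum_cong_neutral[THEN iffD1, rotated -1]) (auto simp: g_def not_less_eq_eq)
  define f where "f = (\<lambda>(N, d). of_nat d * x ^ N)"
  \<comment> \<open>Over the pairs of \<open>N\<close> and a divisor \<open>d\<close>, summing over
    \<open>d\<close> first gives the divisor series, while writing \<open>N\<close> as a multiple of
    \<open>d\<close> gives geometric series. Absolute summability justifies the exchange.\<close>
  let ?B = "SIGMA N:{1..}. {d. d dvd N}"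
  have fin: "finite {d :: nat. d dvd N}" if "N \<in> {1..}" for N using that by auto
  have norm_sum: "(\<Sum>d | d dvd N. norm (f (N, d))) = norm (g N)" for N
  proof -
    have "norm (g N) = real (divisor_sigma 1 N) * norm x ^ N" by (simp add: g_def norm_mult norm_power)
    then show ?thesis by (simp add: f_def divisor_sigma_def norm_mult norm_power sum_distrib_right)
  qed
  have "(\<lambda>p. norm (f p)) summable_on ?B"
  proof (rule Infinite_Sum.abs_summable_on_Sigma_iff[THEN iffD2], intro conjI ballI)
    show "(\<lambda>d. norm (f (N, d))) summable_on {d. d dvd N}" if "N \<in> {1..}" for N
      using fin[OF that] by simp
    have "(\<lambda>N. norm (g N)) summable_on {1..}"
      by (rule summable_on_subset_banach[OF norm_summable_imp_summable_on]) (simp_all add: g_summable)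
    then show "(\<lambda>N. norm (\<Sum>\<^sub>\<infinity>d\<in>{d. d dvd N}. norm (f (N, d)))) summable_on {1..}"
      by (rule summable_on_cong[THEN iffD1, rotated]) (simp add: fin norm_sum)
  qed
  then have "f summable_on ?B" by (rule abs_summable_summable)
  then have "(f has_sum ?S) ?B"
  proof (rule has_sum_SigmaI[rotated 2])
    show "((\<lambda>d. f (N, d)) has_sum g N) {d. d dvd N}" if "N \<in> {1..}" for N
      using fin[OF that] by (auto intro!: has_sum_finiteI simp: f_def g_def divisor_sigma_def sum_distrib_right)
  qed (rule g_sum)
  \<comment> \<open>Both factors of \<open>N\<close> are at least 1, hence the shifts by
    \<open>Suc\<close> and the subtractions of 1 in the witnesses.\<close>
  also have "(f has_sum ?S) ?B \<longleftrightarrow> ((\<lambda>(d, m). of_nat (Suc d) * x ^ (Suc d * Suc m)) has_sum ?S) (UNIV \<times> UNIV)"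
    by (rule has_sum_reindex_bij_witness[of _ "\<lambda>(d, m). (Suc d * Suc m, Suc d)" "\<lambda>(N, d). (d - 1, N div d - 1)"])
       (auto simp: f_def Suc_le_eq simp del: mult_Suc mult_Suc_right power_Suc elim!: dvdE)
  finally have "((\<lambda>(d, m). of_nat (Suc d) * x ^ (Suc d * Suc m)) has_sum ?S) (UNIV \<times> UNIV)" .
  then have "((\<lambda>d. of_nat (Suc d) * x ^ Suc d / (1 - x ^ Suc d)) has_sum ?S) UNIV"
  proof (rule has_sum_SigmaD)
    fix d :: nat
    have lt: "norm (x ^ Suc d) < 1"
      using x unfolding norm_power by (intro le_less_trans[OF power_Suc_le_self]) auto
    have "(\<lambda>m. of_nat (Suc d) * x ^ Suc d * (x ^ Suc d) ^ m) sums (of_nat (Suc d) * x ^ Suc d * (1 / (1 - x ^ Suc d)))"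
      by (intro sums_mult geometric_sums lt)
    moreover have "summable (\<lambda>m. norm (of_nat (Suc d) * x ^ Suc d * (x ^ Suc d) ^ m))"
      unfolding norm_mult norm_power[of "x ^ Suc d"] using lt by (intro summable_mult summable_geometric) auto
    ultimately have "((\<lambda>m. of_nat (Suc d) * x ^ Suc d * (x ^ Suc d) ^ m) has_sum
        of_nat (Suc d) * x ^ Suc d * (1 / (1 - x ^ Suc d))) UNIV"
      by (intro norm_summable_imp_has_sum)
    also have "(\<lambda>m. of_nat (Suc d) * x ^ Suc d * (x ^ Suc d) ^ m) = (\<lambda>m. of_nat (Suc d) * x ^ (Suc d * Suc m))"
      by (simp only: power_mult power_Suc[of "x ^ Suc d"] mult.assoc)
    finally show "((\<lambda>m. case (d, m) of (d, m) \<Rightarrow> of_nat (Suc d) * x ^ (Suc d * Suc m)) has_sum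
        of_nat (Suc d) * x ^ Suc d / (1 - x ^ Suc d)) UNIV"
      by simp
  qed
  then show ?thesis by (rule has_sum_imp_sums)
qed

text \<open>The cofactor of \<open>nome z\<close> in \<open>modular_Delta\<close>, as a function of
  the nome.\<close>

definition euler_prod24 :: "complex \<Rightarrow> complex" where
  "euler_prod24 x = (\<Prod>n. (1 - x ^ Suc n) ^ 24)"

text \<open>\<open>(1 - u) ^ 24 - 1\<close> is \<open>- u\<close> times a geometric sum whose terms
  have norm at most \<open>2 ^ i\<close>.\<close>

lemma norm_one_minus_power_24:
  fixes u :: complex
  assumes "norm u \<le> 1"
  shows "norm ((1 - u) ^ 24 - 1) \<le> (\<Sum>i<24. 2 ^ i) * norm u"
proof -
  have "norm ((1 - u) ^ i) \<le> 2 ^ i" for i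
    unfolding norm_power using norm_triangle_ineq4[of 1 u] assms by (intro power_mono) auto
  then have "norm (\<Sum>i<24. (1 - u) ^ i) \<le> (\<Sum>i<24. 2 ^ i)"
    by (intro order_trans[OF norm_sum] sum_mono)
  then show ?thesis
    unfolding power_diff_1_eq norm_mult by (simp add: mult.commute mult_left_mono)
qed

text \<open>The factors differ from 1 by at most \<open>c * r ^ Suc n\<close>, so the M-test
  applies. No factor vanishes inside the unit disc, and a convergent product of nonzero factors is
  nonzero.\<close>

lemma euler_prod24_nonzero_uniform_limit:
  assumes r: "0 \<le> r" "r < 1"
  shows "uniform_limit (cball 0 r) (\<lambda>N x. \<Prod>n<N. (1 - x ^ Suc n) ^ 24) euler_prod24 sequentially"
    and "norm x \<le> r \<Longrightarrow> euler_prod24 x \<noteq> 0"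
proof -
  define c :: real where "c = (\<Sum>i<24. 2 ^ i)"
  have bound: "norm ((1 - x ^ Suc n) ^ 24 - 1) \<le> c * r ^ Suc n" if "norm x \<le> r" for x :: complex and n
  proof -
    have le: "norm (x ^ Suc n) \<le> r ^ Suc n" unfolding norm_power using that by (rule power_mono) simp
    also have "r ^ Suc n \<le> 1" using r by (intro power_le_one) auto
    finally have "norm ((1 - x ^ Suc n) ^ 24 - 1) \<le> c * norm (x ^ Suc n)"
      unfolding c_def by (rule norm_one_minus_power_24)
    also have "\<dots> \<le> c * r ^ Suc n"
      by (intro mult_left_mono le) (auto simp: c_def sum_nonneg)
    finally show ?thesis .
  qed
  have geom: "summable (\<lambda>n. c * r ^ Suc n)"
    using r by (intro summable_mult summable_Suc_iff[THEN iffD2] summable_geometric) auto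
  have "uniformly_convergent_on (cball 0 r) (\<lambda>N x. \<Prod>n<N. (1 - x ^ Suc n) ^ 24 :: complex)"
  proof (rule uniformly_convergent_on_prod')
    show "uniformly_convergent_on (cball 0 r) (\<lambda>N x. \<Sum>n<N. norm ((1 - x ^ Suc n) ^ 24 - 1 :: complex))"
      by (rule Weierstrass_m_test'[OF _ geom]) (use bound in auto)
  qed (auto intro!: continuous_intros)
  then have lim: "uniform_limit (cball 0 r) (\<lambda>N x. \<Prod>n<N. (1 - x ^ Suc n) ^ 24 :: complex)
      (\<lambda>x. lim (\<lambda>N. \<Prod>n<N. (1 - x ^ Suc n) ^ 24)) sequentially"
    by (simp only: uniformly_convergent_uniform_limit_iff)
  have nz: "(1 - x ^ Suc n) ^ 24 \<noteq> 0" if "norm x \<le> r" for x :: complex and n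
  proof
    assume "(1 - x ^ Suc n) ^ 24 = 0"
    then have "norm x ^ Suc n = 1" by (metis norm_power norm_one right_minus_eq power_eq_0_iff)
    moreover have "norm x ^ Suc n < 1" using that r by (intro le_less_trans[OF power_Suc_le_self]) auto
    ultimately show False by simp
  qed
  have conv: "convergent_prod (\<lambda>n. (1 - x ^ Suc n) ^ 24)" if "norm x \<le> r" for x :: complex
  proof -
    have "summable (\<lambda>n. norm ((1 - x ^ Suc n) ^ 24 - 1))"
      by (rule summable_comparison_test'[OF geom]) (use bound[OF that] in auto)
    then show ?thesis
      by (intro abs_convergent_prod_imp_convergent_prod) (simp add: abs_convergent_prod_conv_summable)
  qed
  show "uniform_limit (cball 0 r) (\<lambda>N x. \<Prod>n<N. (1 - x ^ Suc n) ^ 24) euler_prod24 sequentially"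
    by (rule uniform_limit_cong'[THEN iffD1, OF _ _ lim])
       (auto simp: euler_prod24_def prodinf_eq_lim'[OF conv nz] simp del: power_Suc)
  show "norm x \<le> r \<Longrightarrow> euler_prod24 x \<noteq> 0"
    unfolding euler_prod24_def using prodinf_nonzero[OF conv nz] by blast
qed

text \<open>Locally uniform convergence permits termwise logarithmic differentiation; multiplying by
  \<open>x\<close> turns the terms into those of the Lambert series.\<close>

lemma euler_prod24_deriv:
  assumes x: "norm x < 1"
  obtains D where "(euler_prod24 has_field_derivative D) (at x)"
    "x * D = - 24 * eval_fps (sigma_fps 1) x * euler_prod24 x"
proof -
  define r where "r = (1 + norm x) / 2"
  have r: "0 \<le> r" "r < 1" "norm x < r" using x by (auto simp: r_def field_simps)
  note lim = euler_prod24_nonzero_uniform_limit(1)[OF r(1,2)]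
  have nz: "euler_prod24 x \<noteq> 0" using euler_prod24_nonzero_uniform_limit(2)[OF r(1,2)] r(3) by simp
  have lim': "uniform_limit (ball 0 r) (\<lambda>N x. \<Prod>n<N. (1 - x ^ Suc n) ^ 24) euler_prod24 sequentially"
    by (rule uniform_limit_on_subset[OF lim]) auto
  have "euler_prod24 holomorphic_on ball 0 r"
  proof (rule holomorphic_uniform_sequence)
    show "\<exists>d>0. cball y d \<subseteq> ball 0 r \<and>
        uniform_limit (cball y d) (\<lambda>N x. \<Prod>n<N. (1 - x ^ Suc n) ^ 24) euler_prod24 sequentially"
      if "y \<in> ball 0 r" for y
    proof -
      have "\<forall>y\<in>ball (0 :: complex) r. \<exists>d>0. cball y d \<subseteq> ball 0 r"
        by (rule open_contains_cball[THEN iffD1, OF open_ball])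
      with that obtain d where "d > 0" "cball y d \<subseteq> ball 0 r" by metis
      then show ?thesis by (intro exI[of _ d] conjI uniform_limit_on_subset[OF lim'])
    qed
  qed (auto intro!: holomorphic_intros)
  then have der: "(euler_prod24 has_field_derivative deriv euler_prod24 x) (at x)"
    using r(3) by (intro holomorphic_derivI[of _ "ball 0 r"]) auto
  have "(\<lambda>k. deriv (\<lambda>x. (1 - x ^ Suc k) ^ 24) x / (1 - x ^ Suc k) ^ 24) sums (deriv euler_prod24 x / euler_prod24 x)"
    by (rule logderiv_prodinf_complex_uniform_limit[OF lim' _ nz]) (use r(3) in \<open>auto intro!: holomorphic_intros\<close>)
  then have "(\<lambda>k. x * (deriv (\<lambda>x. (1 - x ^ Suc k) ^ 24) x / (1 - x ^ Suc k) ^ 24)) sums (x * (deriv euler_prod24 x / euler_prod24 x))"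
    by (rule sums_mult)
  moreover have "x * (deriv (\<lambda>x. (1 - x ^ Suc k) ^ 24) x / (1 - x ^ Suc k) ^ 24)
     = - 24 * (of_nat (Suc k) * x ^ Suc k / (1 - x ^ Suc k))" for k
  proof -
    have "norm (x ^ Suc k) < 1" unfolding norm_power using x by (intro le_less_trans[OF power_Suc_le_self]) auto
    then have ne: "1 - x ^ Suc k \<noteq> 0" by auto
    have "((\<lambda>x. (1 - x ^ Suc k) ^ 24) has_field_derivative 24 * (1 - x ^ Suc k) ^ 23 * (- (of_nat (Suc k) * x ^ k))) (at x)"
      by (auto intro!: derivative_eq_intros simp del: power_Suc)
    then have "deriv (\<lambda>x. (1 - x ^ Suc k) ^ 24) x = 24 * (1 - x ^ Suc k) ^ 23 * (- (of_nat (Suc k) * x ^ k))"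
      by (rule DERIV_imp_deriv)
    moreover have "(1 - x ^ Suc k) ^ 24 = (1 - x ^ Suc k) * (1 - x ^ Suc k) ^ 23"
      by (simp flip: power_Suc)
    ultimately show ?thesis using ne by (simp add: divide_simps)
  qed
  ultimately have "(\<lambda>k. - 24 * (of_nat (Suc k) * x ^ Suc k / (1 - x ^ Suc k))) sums (x * (deriv euler_prod24 x / euler_prod24 x))"
    by simp
  moreover have "(\<lambda>k. - 24 * (of_nat (Suc k) * x ^ Suc k / (1 - x ^ Suc k))) sums (- 24 * eval_fps (sigma_fps 1) x)"
    by (intro sums_mult lambert_series_sigma x)
  ultimately have "x * (deriv euler_prod24 x / euler_prod24 x) = - 24 * eval_fps (sigma_fps 1) x"
    by (rule sums_unique2)
  with nz have "x * deriv euler_prod24 x = - 24 * eval_fps (sigma_fps 1) x * euler_prod24 x"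
    by (simp add: field_simps)
  with der show ?thesis using that by blast
qed

theorem modular_Delta_deriv:
  assumes z: "Im z > 0"
  shows "(modular_Delta has_field_derivative 2 * pi * \<i> * (Eis2 z * modular_Delta z)) (at z)"
proof -
  obtain D where D: "(euler_prod24 has_field_derivative D) (at (nome z))"
    "nome z * D = - 24 * eval_fps (sigma_fps 1) (nome z) * euler_prod24 (nome z)"
    using euler_prod24_deriv[OF norm_nome_less_1[OF z]] .
  have "((\<lambda>z. euler_prod24 (nome z)) has_field_derivative D * (2 * pi * \<i> * nome z)) (at z)"
    by (rule DERIV_chain2[where f = euler_prod24 and g = nome, OF D(1) nome_deriv])
  from DERIV_mult[OF nome_deriv this]
  have "((\<lambda>z. nome z * euler_prod24 (nome z)) has_field_derivative
      2 * pi * \<i> * nome z * euler_prod24 (nome z) + nome z * (D * (2 * pi * \<i> * nome z))) (at z)"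
    by (simp add: algebra_simps)
  also have "2 * pi * \<i> * nome z * euler_prod24 (nome z) + nome z * (D * (2 * pi * \<i> * nome z)) =
    2 * pi * \<i> * (nome z * (euler_prod24 (nome z) + nome z * D))" by (simp add: algebra_simps)
  \<comment> \<open>The factor \<open>nome z\<close> contributes the constant term 1 of
    \<open>Eis2\<close>, the product its divisor series.\<close>
  also have "euler_prod24 (nome z) + nome z * D = Eis2 z * euler_prod24 (nome z)"
    unfolding D(2) Eis2_def eval_sigma_fps[OF norm_nome_less_1[OF z]] by (simp add: algebra_simps)
  finally show ?thesis
    by (simp add: modular_Delta_def[abs_def] euler_prod24_def mult_ac)
qed

section \<open>Iterated derivatives and three-term recursions\<close>

text \<open>In closed form, n choose j times the product of \<open>n + k - 1 - i\<close> over
  \<open>i < j\<close>: the coefficients in the expansion of the n-th derivative of a form of weight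
  \<open>k\<close> in powers of a quasimodular form of weight 2.\<close>

primrec gauge_coeff :: "nat \<Rightarrow> nat \<Rightarrow> nat \<Rightarrow> complex" where
  "gauge_coeff k n 0 = 1"
| "gauge_coeff k n (Suc j) =
    gauge_coeff k n j * (of_nat n - of_nat j) * (of_nat n - of_nat j + of_nat k - 1) / of_nat (Suc j)"

lemma gauge_coeff_eq_0: "j > n \<Longrightarrow> gauge_coeff k n j = 0"
proof (induction j)
  case (Suc j)
  then show ?case by (cases "j = n") auto
qed simp

text \<open>The induction step for derivatives needs this: \<open>2 * n + k - j\<close> is the
  weight \<open>2 * (n - j) + k\<close> of \<open>f (n - j)\<close> plus the \<open>j\<close> from
  differentiating \<open>p ^ j\<close>.\<close>

lemma gauge_coeff_pascal:
  "gauge_coeff k (Suc n) (Suc j) =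
    gauge_coeff k n (Suc j) + gauge_coeff k n j * (2 * of_nat n + of_nat k - of_nat j)"
proof (induction j)
  case (Suc j)
  define g where "g = gauge_coeff k n j"
  define J N K :: complex where "J = of_nat j" "N = of_nat n" "K = of_nat k"
  have J: "J + 1 \<noteq> 0" "J + 2 \<noteq> 0"
    unfolding J_N_K_def using of_nat_eq_0_iff[of "Suc j", where ?'a = complex] of_nat_eq_0_iff[of "Suc (Suc j)", where ?'a = complex]
    by (simp_all add: add.commute)
  \<comment> \<open>\<open>h\<close> is the next coefficient; \<open>h(2)\<close> trades
    \<open>g\<close> times its two linear factors for \<open>h * (J + 1)\<close>.\<close>
  define h where "h = g * (N - J) * (N - J + K - 1) / (J + 1)"
  have h: "gauge_coeff k n (Suc j) = h" "h * (J + 1) = g * (N - J) * (N - J + K - 1)"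
    using J by (simp_all add: g_def J_N_K_def h_def add.commute)
  have "gauge_coeff k (Suc n) (Suc (Suc j)) = (h + g * (2 * N + K - J)) * (N - J) * (N - J + K - 1) / (J + 2)"
    unfolding gauge_coeff.simps(2)[of k "Suc n" "Suc j"] Suc.IH h(1) by (simp add: g_def J_N_K_def algebra_simps)
  also have "\<dots> = (h * (N - J) * (N - J + K - 1) + (g * (N - J) * (N - J + K - 1)) * (2 * N + K - J)) / (J + 2)"
    by (simp add: algebra_simps)
  also have "\<dots> = h * (N - J - 1) * (N - J + K - 2) / (J + 2) + h * (2 * N + K - J - 1)"
    unfolding h(2)[symmetric] using J(2) by (simp add: divide_simps, Groebner_Basis.algebra)
  also have "h * (N - J - 1) * (N - J + K - 2) / (J + 2) = gauge_coeff k n (Suc (Suc j))"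
    unfolding gauge_coeff.simps(2)[of k n "Suc j"] h(1) by (simp add: J_N_K_def algebra_simps)
  finally show ?case unfolding h(1) by (simp add: J_N_K_def algebra_simps)
qed (simp add: algebra_simps)

text \<open>The functions \<open>p\<close> and \<open>f n\<close> play the roles of the quasimodular \<open>E2\<close>, shifted by a modular form, and of
  modular iterates of weight \<open>k + 2 n\<close>. Where \<open>p\<close> vanishes, only the term \<open>j = 0\<close> survives.\<close>

lemma higher_deriv_gauge:
  fixes f :: "nat \<Rightarrow> complex \<Rightarrow> complex" and p \<Phi> :: "complex \<Rightarrow> complex" and C :: complex and k :: nat
  assumes S: "open S"
    and f: "\<And>n w. w \<in> S \<Longrightarrow> (f n has_field_derivative C * (of_nat (2 * n + k) * p w * f n w + f (Suc n) w
      - of_nat n * (of_nat n + of_nat k - 1) * \<Phi> w * f (n - 1) w)) (at w)"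
    and p: "\<And>w. w \<in> S \<Longrightarrow> (p has_field_derivative C * (p w ^ 2 + \<Phi> w)) (at w)"
    and w: "w \<in> S"
  shows "(deriv ^^ n) (f 0) w = C ^ n * (\<Sum>j\<le>n. gauge_coeff k n j * p w ^ j * f (n - j) w)"
  using w
proof (induction n arbitrary: w)
  case (Suc n)
  let ?B = "gauge_coeff k n" and ?w = w
  define F where "F w = C ^ n * (\<Sum>j\<le>n. ?B j * p w ^ j * f (n - j) w)" for w
  \<comment> \<open>The terms with \<open>\<Phi>\<close> come from \<open>p ^ j\<close> and from
    \<open>f (n - j)\<close>; they are \<open>G j\<close> and \<open>- G (Suc j)\<close> and hence
    telescope. At \<open>j = 0\<close> the truncated exponent \<open>j - 1\<close> is harmless
    because of the factor \<open>of_nat j\<close>.\<close>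
  define G where "G j = of_nat j * ?B j * p w ^ (j - 1) * f (n - j) w" for j
  define T where "T j = ?B j * p w ^ j * f (Suc n - j) w + ?B j * (2 * of_nat n + of_nat k - of_nat j) * p w ^ Suc j * f (n - j) w
    + \<Phi> w * (G j - G (Suc j))" for j
  have term_deriv: "((\<lambda>w. ?B j * p w ^ j * f (n - j) w) has_field_derivative C * T j) (at w)" if "j \<le> n" for j
  proof -
    have "((\<lambda>w. ?B j * p w ^ j * f (n - j) w) has_field_derivative
      ?B j * (of_nat j * p w ^ (j - 1) * (C * (p w ^ 2 + \<Phi> w))) * f (n - j) w
      + ?B j * p w ^ j * (C * (of_nat (2 * (n - j) + k) * p w * f (n - j) w + f (Suc (n - j)) w
      - of_nat (n - j) * (of_nat (n - j) + of_nat k - 1) * \<Phi> w * f (n - j - 1) w))) (at w)"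
      by (rule derivative_eq_intros f[OF Suc.prems] p[OF Suc.prems] refl)+ (simp add: mult_ac)
    also have "?B j * (of_nat j * p w ^ (j - 1) * (C * (p w ^ 2 + \<Phi> w))) * f (n - j) w
      + ?B j * p w ^ j * (C * (of_nat (2 * (n - j) + k) * p w * f (n - j) w + f (Suc (n - j)) w
      - of_nat (n - j) * (of_nat (n - j) + of_nat k - 1) * \<Phi> w * f (n - j - 1) w)) = C * T j"
    proof -
      have "of_nat (Suc j) * ?B (Suc j) = ?B j * of_nat (n - j) * (of_nat (n - j) + of_nat k - 1)"
        using that of_nat_eq_0_iff[of "Suc j", where ?'a = complex] by (simp add: of_nat_diff del: of_nat_Suc)
      then have "G (Suc j) = ?B j * of_nat (n - j) * (of_nat (n - j) + of_nat k - 1) * p w ^ j * f (n - j - 1) w"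
        by (simp add: G_def del: of_nat_Suc gauge_coeff.simps)
      moreover have "of_nat j * p w ^ (j - 1) * p w ^ 2 = of_nat j * p w ^ Suc j"
        by (cases j) (simp_all add: power2_eq_square)
      moreover have "Suc (n - j) = Suc n - j" "of_nat (n - j) = (of_nat n - of_nat j :: complex)"
        using that by (simp_all add: Suc_diff_le of_nat_diff)
      moreover have "G j = of_nat j * ?B j * p w ^ (j - 1) * f (n - j) w" by (simp add: G_def)
      moreover have "b * (i * r * (C * (x ^ 2 + y))) * u + b * s * (C * ((2 * m + l) * x * u + v - m * (m + l - 1) * y * t)) =
          C * (b * s * v + b * (2 * N + l - i) * (x * s) * u + y * (i * b * r * u - b * m * (m + l - 1) * s * t))"
        if "i * r * x ^ 2 = i * (x * s)" "m = N - i" for b i r x y u s m l v t N :: complex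
        using that by Groebner_Basis.algebra
      ultimately show ?thesis
        unfolding T_def of_nat_add of_nat_mult of_nat_numeral power_Suc by presburger
    qed
    finally show ?thesis .
  qed
  have "(F has_field_derivative C ^ n * (\<Sum>j\<le>n. C * T j)) (at w)"
    unfolding F_def by (intro DERIV_cmult DERIV_sum term_deriv) auto
  also have "(\<Sum>j\<le>n. C * T j) = C * (\<Sum>j\<le>n. T j)" by (simp add: sum_distrib_left)
  also have "(\<Sum>j\<le>n. T j) = (\<Sum>j\<le>Suc n. gauge_coeff k (Suc n) j * p w ^ j * f (Suc n - j) w)"
  proof -
    have "(\<Sum>j\<le>n. G j - G (Suc j)) = G 0 - G (Suc n)" by (rule sum_telescope)
    also have "\<dots> = 0" by (simp add: G_def gauge_coeff_eq_0 del: gauge_coeff.simps)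
    finally have tel: "(\<Sum>j\<le>n. \<Phi> w * (G j - G (Suc j))) = 0" by (simp flip: sum_distrib_left)
    \<comment> \<open>The added top summand is 0; splitting off the bottom one then aligns both sums
      at \<open>p w ^ Suc j\<close> for the Pascal rule.\<close>
    have "(\<Sum>j\<le>n. ?B j * p w ^ j * f (Suc n - j) w) = (\<Sum>j\<le>Suc n. ?B j * p w ^ j * f (Suc n - j) w)"
      by (simp add: gauge_coeff_eq_0 del: gauge_coeff.simps)
    also have "\<dots> = f (Suc n) w + (\<Sum>j\<le>n. ?B (Suc j) * p w ^ Suc j * f (n - j) w)"
      by (subst sum.atMost_Suc_shift) (simp del: gauge_coeff.simps(2))
    finally have "(\<Sum>j\<le>n. T j) = f (Suc n) w + (\<Sum>j\<le>n. ?B (Suc j) * p w ^ Suc j * f (n - j) w)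
        + (\<Sum>j\<le>n. ?B j * (2 * of_nat n + of_nat k - of_nat j) * p w ^ Suc j * f (n - j) w)"
      unfolding T_def sum.distrib tel by simp
    also have "\<dots> = f (Suc n) w + (\<Sum>j\<le>n. gauge_coeff k (Suc n) (Suc j) * p w ^ Suc j * f (n - j) w)"
      unfolding add.assoc sum.distrib[symmetric] gauge_coeff_pascal by (simp only: algebra_simps)
    also have "\<dots> = (\<Sum>j\<le>Suc n. gauge_coeff k (Suc n) j * p w ^ j * f (Suc n - j) w)"
      by (subst sum.atMost_Suc_shift) (simp del: gauge_coeff.simps(2))
    finally show ?thesis .
  qed
  finally have F_deriv: "(F has_field_derivative C ^ Suc n *
      (\<Sum>j\<le>Suc n. gauge_coeff k (Suc n) j * p w ^ j * f (Suc n - j) w)) (at w)"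
    by (simp add: mult_ac)
  have "((deriv ^^ n) (f 0) has_field_derivative C ^ Suc n *
      (\<Sum>j\<le>Suc n. gauge_coeff k (Suc n) j * p w ^ j * f (Suc n - j) w)) (at w)"
    by (rule has_field_derivative_transform_within_open[OF F_deriv S Suc.prems]) (simp add: Suc.IH F_def)
  then show ?case by (simp add: DERIV_imp_deriv)
qed simp

text \<open>\<open>D\<close>, \<open>P\<close>, \<open>Q\<close>, \<open>R\<close> obey the
  equations of Delta, E2, E4, E6, and \<open>Y\<close> is a root of \<open>Q\<close>. The
  coefficients \<open>a1\<close> to \<open>a4\<close> are those for which
  \<open>D * (Y / l) ^ n * q n\<close>, with \<open>q n\<close> evaluated at an affine coordinate of
  \<open>R / Y ^ 3\<close> centred at \<open>w0\<close>, satisfies the hypothesis of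
  \<open>higher_deriv_gauge\<close> in weight 12.\<close>

lemma higher_deriv_by_recursion:
  fixes D P Q R Y :: "complex \<Rightarrow> complex" and C c s l t0 :: complex
    and a1 a2 a3 a4 :: "complex poly" and q :: "nat \<Rightarrow> complex poly"
  assumes S: "open S" "w0 \<in> S"
    and ode: "\<And>w. w \<in> S \<Longrightarrow> (D has_field_derivative C * (P w * D w)) (at w)"
      "\<And>w. w \<in> S \<Longrightarrow> (P has_field_derivative C * ((P w ^ 2 - Q w) / 12)) (at w)"
      "\<And>w. w \<in> S \<Longrightarrow> (R has_field_derivative C * ((P w * R w - Q w ^ 2) / 2)) (at w)"
      "\<And>w. w \<in> S \<Longrightarrow> (Y has_field_derivative C * ((P w * Q w - R w) / 3) / (2 * Y w)) (at w)"
    and Y: "\<And>w. w \<in> S \<Longrightarrow> Y w ^ 2 = Q w" "\<And>w. w \<in> S \<Longrightarrow> Y w \<noteq> 0"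
    and nz: "s \<noteq> 0" "l \<noteq> 0"
    and a1: "\<And>t. poly a1 t = l * c * (s * (t + t0))"
    and a2: "\<And>t. poly a2 t = l * (c - 1) * (s * (t + t0)) / 6"
    and a3: "\<And>t. poly a3 t = l * ((s * (t + t0)) ^ 2 - 1) / (2 * s)"
    and a4: "\<And>t. poly a4 t = - (l ^ 2) * (1 - 6 * c + (s * (t + t0)) ^ 2 * (c ^ 2 + 4 * c)) / 144"
    and q: "q 0 = 1" "q 1 = a1"
      "\<And>n. n \<ge> 1 \<Longrightarrow> q (n + 1) = (a1 + of_nat n * a2) * q n + a3 * pderiv (q n)
         + of_nat (n * (n + 11)) * a4 * q (n - 1)"
    and w0: "P w0 = c * R w0 / Q w0" "R w0 / Y w0 ^ 3 = s * t0"
  shows "(deriv ^^ n) D w0 = C ^ n * D w0 * (Y w0 / l) ^ n * poly (q n) 0"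
proof -
  define u where "u w = R w / Y w ^ 3" for w
  define t where "t w = u w / s - t0" for w
  define p where "p w = (P w - c * u w * Y w) / 12" for w
  \<comment> \<open>What remains of the derivative of \<open>p\<close>, divided by \<open>C\<close>,
    after \<open>p w ^ 2\<close> is removed, expressed in \<open>u\<close> and
    \<open>Y\<close>.\<close>
  define \<Phi> where "\<Phi> w = - (Y w ^ 2) * (1 - 6 * c + u w ^ 2 * (c ^ 2 + 4 * c)) / 144" for w
  define f where "f n w = D w * (Y w / l) ^ n * poly (q n) (t w)" for n w
  have st: "s * (t w + t0) = u w" for w using nz by (simp add: t_def)
  have rel: "Q w = Y w ^ 2" "R w = u w * Y w ^ 3" "P w = 12 * p w + c * u w * Y w" if "w \<in> S" for w
  proof -
    show "R w = u w * Y w ^ 3" using Y(2)[OF that] by (simp add: u_def)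
  qed (simp_all add: p_def Y(1)[OF that] field_simps)
  have Y': "(Y has_field_derivative C * (Y w * (2 * p w) + Y w ^ 2 * (c - 1) * u w / 6)) (at w)" if w: "w \<in> S" for w
  proof -
    have "C * ((P w * Q w - R w) / 3) / (2 * Y w) = C * (Y w * (2 * p w) + Y w ^ 2 * (c - 1) * u w / 6)"
      unfolding rel[OF w] using Y(2)[OF w] by (simp add: field_simps power2_eq_square power3_eq_cube)
    with ode(4)[OF w] show ?thesis by simp
  qed
  have u': "(u has_field_derivative C * Y w * (u w ^ 2 - 1) / 2) (at w)" if w: "w \<in> S" for w
  proof -
    have "(u has_field_derivative (C * ((P w * R w - Q w ^ 2) / 2) * Y w ^ 3 - R w * (3 * Y w ^ 2 *
        (C * (Y w * (2 * p w) + Y w ^ 2 * (c - 1) * u w / 6)))) / (Y w ^ 3 * Y w ^ 3)) (at w)"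
      unfolding u_def[abs_def] u_def
      by (rule derivative_eq_intros ode(3)[OF w] Y'[OF w, unfolded u_def] refl)+ (use Y(2)[OF w] in \<open>auto simp: field_simps\<close>)
    also have "(C * ((P w * R w - Q w ^ 2) / 2) * Y w ^ 3 - R w * (3 * Y w ^ 2 *
        (C * (Y w * (2 * p w) + Y w ^ 2 * (c - 1) * u w / 6)))) / (Y w ^ 3 * Y w ^ 3) = C * Y w * (u w ^ 2 - 1) / 2"
      unfolding rel[OF w] using Y(2)[OF w] by (simp add: divide_simps, Groebner_Basis.algebra)
    finally show ?thesis .
  qed
  have p': "(p has_field_derivative C * (p w ^ 2 + \<Phi> w)) (at w)" if w: "w \<in> S" for w
  proof -
    have "((\<lambda>w. (P w - c * u w * Y w) / 12) has_field_derivative (C * ((P w ^ 2 - Q w) / 12) - (c * (C * Y w * (u w ^ 2 - 1) / 2) * Y w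
        + c * u w * (C * (Y w * (2 * p w) + Y w ^ 2 * (c - 1) * u w / 6)))) / 12) (at w)"
      by (rule derivative_eq_intros ode(2)[OF w] u'[OF w] Y'[OF w] refl)+ (simp_all add: field_simps)
    also have "(C * ((P w ^ 2 - Q w) / 12) - (c * (C * Y w * (u w ^ 2 - 1) / 2) * Y w
        + c * u w * (C * (Y w * (2 * p w) + Y w ^ 2 * (c - 1) * u w / 6)))) / 12 = C * (p w ^ 2 + \<Phi> w)"
      unfolding rel[OF w] \<Phi>_def by (simp add: field_simps, Groebner_Basis.algebra)
    also have "(\<lambda>w. (P w - c * u w * Y w) / 12) = p" by (simp add: p_def[abs_def])
    finally show ?thesis .
  qed
  have t': "(t has_field_derivative C * Y w * (u w ^ 2 - 1) / (2 * s)) (at w)" if w: "w \<in> S" for w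
    unfolding t_def[abs_def] using nz by (auto intro!: derivative_eq_intros u'[OF w])
  \<comment> \<open>The recursion extends to \<open>n = 0\<close>: the derivative of
    \<open>q 0\<close> vanishes and the factor \<open>n\<close> kills the last term.\<close>
  have q_Suc: "poly (q (Suc n)) x = (l * c * v + of_nat n * (l * (c - 1) * v / 6)) * poly (q n) x
      + l * (v ^ 2 - 1) / (2 * s) * poly (pderiv (q n)) x
      - of_nat n * (of_nat n + 11) * (l ^ 2 * (1 - 6 * c + v ^ 2 * (c ^ 2 + 4 * c)) / 144) * poly (q (n - 1)) x"
    if "v = s * (x + t0)" for n x v
  proof (cases "n = 0")
    case False
    then have "poly (q (Suc n)) x = (poly a1 x + of_nat n * poly a2 x) * poly (q n) x
        + poly a3 x * poly (pderiv (q n)) x + of_nat n * (of_nat n + 11) * poly a4 x * poly (q (n - 1)) x"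
      using q(3)[of n] by (simp add: algebra_simps)
    then show ?thesis
      unfolding a1 a2 a3 a4 that[symmetric] by simp
  qed (simp add: q(1) q(2)[simplified] a1 that)
  have f': "(f n has_field_derivative C * (of_nat (2 * n + 12) * p w * f n w + f (Suc n) w
      - of_nat n * (of_nat n + of_nat 12 - 1) * \<Phi> w * f (n - 1) w)) (at w)" if w: "w \<in> S" for n w
  proof -
    have dY: "((\<lambda>w. (Y w / l) ^ n) has_field_derivative
        of_nat n * (Y w / l) ^ (n - 1) * (C * (Y w * (2 * p w) + Y w ^ 2 * (c - 1) * u w / 6) / l)) (at w)"
      using DERIV_power[OF DERIV_cdivide[OF Y'[OF w], of l], of n] by (simp add: mult_ac)
    have dq: "((\<lambda>w. poly (q n) (t w)) has_field_derivative
        poly (pderiv (q n)) (t w) * (C * Y w * (u w ^ 2 - 1) / (2 * s))) (at w)"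
      by (rule DERIV_chain2[where f = "poly (q n)" and g = t, OF poly_DERIV t'[OF w]])
    have "(f n has_field_derivative C * (P w * D w) * (Y w / l) ^ n * poly (q n) (t w)
      + D w * (of_nat n * (Y w / l) ^ (n - 1) * (C * (Y w * (2 * p w) + Y w ^ 2 * (c - 1) * u w / 6) / l)) * poly (q n) (t w)
      + D w * (Y w / l) ^ n * (poly (pderiv (q n)) (t w) * (C * Y w * (u w ^ 2 - 1) / (2 * s)))) (at w)"
      unfolding f_def[abs_def]
      using DERIV_mult[OF DERIV_mult[OF ode(1)[OF w] dY] dq] by (rule DERIV_cong) (simp add: algebra_simps)
    also have "C * (P w * D w) * (Y w / l) ^ n * poly (q n) (t w)
      + D w * (of_nat n * (Y w / l) ^ (n - 1) * (C * (Y w * (2 * p w) + Y w ^ 2 * (c - 1) * u w / 6) / l)) * poly (q n) (t w)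
      + D w * (Y w / l) ^ n * (poly (pderiv (q n)) (t w) * (C * Y w * (u w ^ 2 - 1) / (2 * s)))
      = C * (of_nat (2 * n + 12) * p w * f n w + f (Suc n) w
      - of_nat n * (of_nat n + of_nat 12 - 1) * \<Phi> w * f (n - 1) w)"
    proof -
      \<comment> \<open>With \<open>Y w = l * y\<close> the claim becomes a polynomial identity. The
        relation \<open>pow\<close> also covers \<open>n = 0\<close>, where \<open>n - 1\<close> is
        truncated.\<close>
      define y N where "y = Y w / l" and "N = (of_nat n :: complex)"
      have Yl: "Y w = l * y" using nz by (simp add: y_def)
      have cancel: "C * (l * y * (2 * p w) + (l * y) ^ 2 * (c - 1) * u w / 6) / l =
          C * (y * (2 * p w) + l * y ^ 2 * (c - 1) * u w / 6)"
        using nz by (simp add: field_simps power2_eq_square)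
      have pow: "N * y ^ n = N * (y * y ^ (n - 1))" by (cases n) (simp_all add: N_def)
      have "C * ((12 * p' + c * v * (l * y)) * d) * E * X
        + d * (N * A * (C * (y * (2 * p') + l * y ^ 2 * (c - 1) * v / 6))) * X
        + d * E * (X' * (C * (l * y) * (v ^ 2 - 1) * r)) =
        C * ((2 * N + 12) * p' * (d * E * X)
          + d * (y * E) * ((l * c * v + N * (l * (c - 1) * v / 6)) * X + l * (v ^ 2 - 1) * r * X'
              - N * (N + 11) * (l ^ 2 * H / 144) * X0)
          - N * (N + 12 - 1) * (- ((l * y) ^ 2) * H / 144) * (d * A * X0))"
        if "N * E = N * (y * A)" for p' v d E A X X' X0 r H :: complex
        using that by Groebner_Basis.algebra
      note ring = this[OF pow]
      show ?thesis
        unfolding f_def q_Suc[OF st[symmetric]] rel(3)[OF w] \<Phi>_def y_def[symmetric] N_def[symmetric] Yl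
          of_nat_add of_nat_mult of_nat_numeral power_Suc cancel
        using ring[of "p w" "u w" "D w" "poly (q n) (t w)" "poly (pderiv (q n)) (t w)" "1 / (2 * s)"
          "1 - 6 * c + u w ^ 2 * (c ^ 2 + 4 * c)" "poly (q (n - 1)) (t w)"]
        by (simp add: nz)
    qed
    finally show ?thesis .
  qed
  have f0: "f 0 = D" by (simp add: f_def[abs_def] q(1))
  \<comment> \<open>\<open>c * R / Q\<close> equals \<open>c * u * Y\<close>, so the hypothesis on
    \<open>P w0\<close> says that \<open>p\<close> vanishes there; then only \<open>j = 0\<close>
    survives, with \<open>0 ^ 0 = 1\<close>.\<close>
  have "p w0 = 0" using w0 Y(1)[OF S(2)] Y(2)[OF S(2)]
    by (simp add: p_def u_def field_simps power2_eq_square power3_eq_cube)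
  moreover have "t w0 = 0" using w0(2) nz by (simp add: t_def u_def)
  moreover have "(\<Sum>j\<le>n. gauge_coeff 12 n j * 0 ^ j * f (n - j) w0) = f n w0"
    by (subst sum.atMost_shift) simp
  ultimately show ?thesis
    using higher_deriv_gauge[where f = f and k = 12 and p = p and \<Phi> = \<Phi>, OF S(1) f' p' S(2), of n]
    unfolding f0 by (simp add: f_def)
qed

section \<open>The disc coordinate\<close>

text \<open>The Moebius map of \<open>sigma_matrix z\<close> with the common scalar cancelled; for
  \<open>Im z > 0\<close> it maps the unit disc onto the upper half-plane.\<close>

definition disc_param :: "complex \<Rightarrow> complex \<Rightarrow> complex" where
  "disc_param z w = (z - cnj z * w) / (1 - w)"

definition disc_pullback :: "nat \<Rightarrow> (complex \<Rightarrow> complex) \<Rightarrow> complex \<Rightarrow> complex \<Rightarrow> complex" where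
  "disc_pullback k f z w = f (disc_param z w) / (1 - w) ^ k"

text \<open>The correction term makes \<open>disc_E2\<close> satisfy Ramanujan's equations with respect to \<open>w\<close>; at \<open>w = 0\<close> it is the
  non-holomorphic term of \<open>Eis2_star\<close>.\<close>

definition disc_E2 :: "complex \<Rightarrow> complex \<Rightarrow> complex" where
  "disc_E2 z w = disc_pullback 2 Eis2 z w - 3 / (of_real pi * of_real (Im z) * (1 - w))"

lemma disc_param_0 [simp]: "disc_param z 0 = z"
  by (simp add: disc_param_def)

lemma disc_pullback_0 [simp]: "disc_pullback k f z 0 = f z"
  by (simp add: disc_pullback_def)

lemma disc_E2_0 [simp]: "disc_E2 z 0 = Eis2_star z"
  by (simp add: disc_E2_def Eis2_star_def)

lemma disc_param_deriv:
  fixes z w :: complex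
  assumes "w \<noteq> 1"
  shows "(disc_param z has_field_derivative 2 * \<i> * Im z / (1 - w) ^ 2) (at w)"
proof -
  have "(disc_param z has_field_derivative ((- cnj z) * (1 - w) - (z - cnj z * w) * (- 1)) / ((1 - w) * (1 - w))) (at w)"
    unfolding disc_param_def[abs_def] using assms by (auto intro!: derivative_eq_intros)
  also have "(- cnj z) * (1 - w) - (z - cnj z * w) * (- 1) = z - cnj z" by (simp add: algebra_simps)
  also have "z - cnj z = 2 * \<i> * Im z" by (simp add: complex_diff_cnj mult_ac)
  finally show ?thesis by (simp add: power2_eq_square)
qed

lemma inverse_one_minus_deriv:
  fixes w :: complex
  assumes "w \<noteq> 1"
  shows "((\<lambda>w. inverse (1 - w)) has_field_derivative inverse (1 - w) ^ 2) (at w)"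
  using assms by (auto intro!: derivative_eq_intros simp: power2_eq_square)

text \<open>The chain rule yields \<open>2 * pi * \<i>\<close> times \<open>2 * \<i> * Im z\<close>,
  the constant in front. The term from the automorphy factor is written as a multiple of
  \<open>k\<close> with the same constant, so that one correction of E2 absorbs it in all
  weights.\<close>

lemma disc_pullback_deriv:
  fixes z w :: complex
  assumes w: "w \<noteq> 1" and f: "(f has_field_derivative 2 * pi * \<i> * f') (at (disc_param z w))" and z: "Im z > 0"
  shows "(disc_pullback k f z has_field_derivative - 4 * of_real pi * of_real (Im z) *
    (f' / (1 - w) ^ (k + 2) - of_nat k * (1 / (4 * of_real pi * of_real (Im z) * (1 - w))) * disc_pullback k f z w)) (at w)"
proof -
  have "((\<lambda>w. f (disc_param z w)) has_field_derivative 2 * pi * \<i> * f' * (2 * \<i> * Im z / (1 - w) ^ 2)) (at w)"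
    by (rule DERIV_chain2[OF f disc_param_deriv[OF w]])
  moreover have "((\<lambda>w. 1 / (1 - w) ^ k) has_field_derivative of_nat k / (1 - w) ^ (k + 1)) (at w)"
  proof -
    from DERIV_power[OF inverse_one_minus_deriv[OF w], of k] show ?thesis
      by (cases k) (simp_all add: divide_inverse power_inverse power2_eq_square mult_ac)
  qed
  ultimately have "((\<lambda>w. f (disc_param z w) * (1 / (1 - w) ^ k)) has_field_derivative
    2 * pi * \<i> * f' * (2 * \<i> * Im z / (1 - w) ^ 2) * (1 / (1 - w) ^ k) + of_nat k / (1 - w) ^ (k + 1) * f (disc_param z w)) (at w)"
    by (rule DERIV_mult)
  also have "2 * pi * \<i> * f' * (2 * \<i> * Im z / (1 - w) ^ 2) * (1 / (1 - w) ^ k) + of_nat k / (1 - w) ^ (k + 1) * f (disc_param z w)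
    = - 4 * of_real pi * of_real (Im z) *
      (f' / (1 - w) ^ (k + 2) - of_nat k * (1 / (4 * of_real pi * of_real (Im z) * (1 - w))) * disc_pullback k f z w)"
    using w z by (simp add: disc_pullback_def power_add field_simps power2_eq_square)
  finally show ?thesis by (simp add: disc_pullback_def[abs_def])
qed

text \<open>In weight \<open>k\<close> E2 occurs with coefficient \<open>k / 12\<close>, so
  subtracting \<open>12 * e * v\<close> from it cancels the automorphy term. In the equation for
  \<open>P\<close> the square of the correction matches its derivative by
  \<open>C * e = -1\<close>.\<close>

lemma disc_ramanujan:
  fixes z w :: complex
  assumes z: "Im z > 0" and w: "w \<noteq> 1" "Im (disc_param z w) > 0"
  defines "C \<equiv> - 4 * of_real pi * of_real (Im z) :: complex"
  defines "P \<equiv> disc_E2 z" and "Q \<equiv> disc_pullback 4 Eis4 z" and "R \<equiv> disc_pullback 6 Eis6 z"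
    and "D \<equiv> disc_pullback 12 modular_Delta z"
  shows "(D has_field_derivative C * (P w * D w)) (at w)"
    and "(P has_field_derivative C * ((P w ^ 2 - Q w) / 12)) (at w)"
    and "(Q has_field_derivative C * ((P w * Q w - R w) / 3)) (at w)"
    and "(R has_field_derivative C * ((P w * R w - Q w ^ 2) / 2)) (at w)"
proof -
  have w1: "1 - w \<noteq> 0" using w by simp
  define v where "v = 1 / (1 - w)"
  define e :: complex where "e = 1 / (4 * of_real pi * of_real (Im z))"
  let ?t = "disc_param z w"
  have C: "C * e = -1" using z by (simp add: C_def e_def)
  have vals: "P w = Eis2 ?t * v ^ 2 - 12 * e * v" "Q w = Eis4 ?t * v ^ 4" "R w = Eis6 ?t * v ^ 6" "D w = modular_Delta ?t * v ^ 12"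
    by (simp_all add: P_def disc_E2_def disc_pullback_def Q_def R_def D_def v_def e_def power_divide)
  have v_pow: "x / (1 - w) ^ n = x * v ^ n" for x n by (simp add: v_def power_divide)
  have ev: "1 / (4 * of_real pi * of_real (Im z) * (1 - w)) = e * v" by (simp add: e_def v_def)
  note der = disc_pullback_deriv[OF w(1) _ z, unfolded ev v_pow, folded C_def]
  note ram = ramanujan_Eis[OF w(2)]
  have "(D has_field_derivative C * (Eis2 ?t * modular_Delta ?t * v ^ 14 - 12 * (e * v) * D w)) (at w)"
    using der[OF modular_Delta_deriv[OF w(2)], of 12] by (simp add: D_def)
  then show "(D has_field_derivative C * (P w * D w)) (at w)"
    by (rule DERIV_cong) (simp only: vals, Groebner_Basis.algebra)
  have "(Q has_field_derivative C * ((Eis2 ?t * Eis4 ?t - Eis6 ?t) / 3 * v ^ 6 - 4 * (e * v) * Q w)) (at w)"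
    using der[OF ram(2), of 4] by (simp add: Q_def)
  then show "(Q has_field_derivative C * ((P w * Q w - R w) / 3)) (at w)"
    by (rule DERIV_cong) (simp only: vals, Groebner_Basis.algebra)
  have "(R has_field_derivative C * ((Eis2 ?t * Eis6 ?t - Eis4 ?t ^ 2) / 2 * v ^ 8 - 6 * (e * v) * R w)) (at w)"
    using der[OF ram(3), of 6] by (simp add: R_def)
  then show "(R has_field_derivative C * ((P w * R w - Q w ^ 2) / 2)) (at w)"
    by (rule DERIV_cong) (simp only: vals, Groebner_Basis.algebra)
  have "(disc_pullback 2 Eis2 z has_field_derivative C * ((Eis2 ?t ^ 2 - Eis4 ?t) / 12 * v ^ 4 - 2 * (e * v) * (Eis2 ?t * v ^ 2))) (at w)"
    using der[OF ram(1), of 2] by (simp add: disc_pullback_def v_pow)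
  moreover have "((\<lambda>w. 3 / (of_real pi * of_real (Im z) * (1 - w))) has_field_derivative 12 * e * v ^ 2) (at w)"
  proof -
    have "(\<lambda>w. 3 / (of_real pi * of_real (Im z) * (1 - w))) = (\<lambda>w. 12 * e * inverse (1 - w))"
      by (simp add: e_def inverse_eq_divide fun_eq_iff)
    with DERIV_cmult[OF inverse_one_minus_deriv[OF w(1)], of "12 * e"] show ?thesis
      by (simp add: v_def inverse_eq_divide)
  qed
  ultimately have "(P has_field_derivative C * ((Eis2 ?t ^ 2 - Eis4 ?t) / 12 * v ^ 4 - 2 * (e * v) * (Eis2 ?t * v ^ 2)) - 12 * e * v ^ 2) (at w)"
    unfolding P_def disc_E2_def[abs_def] by (rule DERIV_diff)
  then show "(P has_field_derivative C * ((P w ^ 2 - Q w) / 12)) (at w)"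
  proof (rule DERIV_cong)
    show "C * ((Eis2 ?t ^ 2 - Eis4 ?t) / 12 * v ^ 4 - 2 * (e * v) * (Eis2 ?t * v ^ 2)) - 12 * e * v ^ 2 = C * ((P w ^ 2 - Q w) / 12)"
      using C unfolding vals by Groebner_Basis.algebra
  qed
qed

text \<open>With \<open>c = 2 * \<i> * Im z\<close> the determinant is \<open>1 / c\<close> and the
  automorphy factor \<open>(1 - w) / c\<close>; the powers of \<open>c\<close> combine to exponent
  \<open>12 - 6\<close>.\<close>

lemma slash12_sigma_matrix:
  assumes "Im z \<noteq> 0"
  shows "slash12 f (sigma_matrix z) w = (2 * \<i> * Im z) ^ 6 * disc_pullback 12 f z w"
proof -
  define c where "c = 2 * \<i> * complex_of_real (Im z)"
  have c: "c \<noteq> 0" "z - cnj z = c" using assms by (simp_all add: c_def complex_diff_cnj mult_ac)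
  have entries: "vec_nth (vec_nth (sigma_matrix z) 1) 1 = - cnj z / c" "vec_nth (vec_nth (sigma_matrix z) 1) 2 = z / c"
    "vec_nth (vec_nth (sigma_matrix z) 2) 1 = - 1 / c" "vec_nth (vec_nth (sigma_matrix z) 2) 2 = 1 / c"
    by (simp_all add: sigma_matrix_def c_def matrix_matrix_mult_def Finite_Cartesian_Product.mat_def sum_2)
  have det: "Determinants.det (sigma_matrix z) = 1 / c"
  proof -
    have "Determinants.det (sigma_matrix z) = (z - cnj z) / (c * c)"
      unfolding det_2 entries by (simp add: diff_divide_distrib)
    then show ?thesis using c by simp
  qed
  have denom: "vec_nth (vec_nth (sigma_matrix z) 2) 1 * w + vec_nth (vec_nth (sigma_matrix z) 2) 2 = (1 - w) / c"
    unfolding entries by (simp add: diff_divide_distrib)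
  have numer: "vec_nth (vec_nth (sigma_matrix z) 1) 1 * w + vec_nth (vec_nth (sigma_matrix z) 1) 2 = (z - cnj z * w) / c"
    unfolding entries by (simp add: diff_divide_distrib)
  have moeb: "moebius_action (sigma_matrix z) w = disc_param z w"
    unfolding moebius_action_def denom numer disc_param_def using c(1) by simp
  have "((1 - w) / c) powi (- 12) = c ^ 12 / (1 - w) ^ 12"
    by (simp add: power_int_minus power_divide)
  moreover have "(1 / c) ^ 6 * X * (c ^ 12 / Y) = c ^ 6 * (X / Y)" for X Y
  proof -
    have "(1 / c) ^ 6 * c ^ 12 = c ^ 6"
      using power_diff[OF c(1), of 6 12] by (simp add: power_divide)
    then show ?thesis by (metis mult.assoc mult.commute times_divide_eq_right)
  qed
  ultimately show ?thesis
    unfolding slash12_def det denom moeb disc_pullback_def c_def[symmetric] by (simp only:)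
qed

lemma taylor_coeff_eq:
  assumes "Im z \<noteq> 0"
  shows "taylor_coeff z f n = (deriv ^^ n) (\<lambda>w. (2 * \<i> * Im z) ^ 6 * disc_pullback 12 f z w) 0 / fact n"
  by (simp add: taylor_coeff_def fps_expansion_def slash12_sigma_matrix[OF assms, abs_def])

section \<open>Non-vanishing of Eisenstein series\<close>

text \<open>A geometric majorant: the divisor sum is at most \<open>Suc n ^ 6\<close>, and
  \<open>Suc n \<le> 2 ^ n\<close> bounds this by \<open>64 ^ n\<close>.\<close>

lemma norm_sigma_tail_le:
  fixes x :: complex
  assumes k: "k \<le> 5" and x: "64 * norm x < 1"
  shows "norm (\<Sum>n. of_nat (divisor_sigma k (Suc n)) * x ^ Suc n) \<le> norm x / (1 - 64 * norm x)"
proof -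
  have bound: "norm (of_nat (divisor_sigma k (Suc n)) * x ^ Suc n) \<le> norm x * (64 * norm x) ^ n" for n
  proof -
    have "divisor_sigma k (Suc n) \<le> Suc n ^ Suc k" by (rule divisor_sigma_le)
    also have "\<dots> \<le> Suc n ^ 6" using k by (intro power_increasing) auto
    also have "\<dots> \<le> (2 ^ n) ^ 6" by (intro power_mono) (simp_all add: Suc_le_eq)
    also have "\<dots> = (2 ^ 6) ^ n" by (simp only: power_mult[symmetric] mult.commute)
    also have "\<dots> = 64 ^ n" by simp
    finally have "real (divisor_sigma k (Suc n)) \<le> 64 ^ n" by (metis of_nat_le_iff of_nat_numeral of_nat_power)
    then have "real (divisor_sigma k (Suc n)) * norm x ^ Suc n \<le> 64 ^ n * norm x ^ Suc n"
      by (intro mult_right_mono) auto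
    then show ?thesis by (simp add: norm_mult norm_power power_mult_distrib mult_ac)
  qed
  have geom: "(\<lambda>n. norm x * (64 * norm x) ^ n) sums (norm x * (1 / (1 - 64 * norm x)))"
    using x by (intro sums_mult geometric_sums) auto
  have "norm (\<Sum>n. of_nat (divisor_sigma k (Suc n)) * x ^ Suc n) \<le> (\<Sum>n. norm x * (64 * norm x) ^ n)"
    by (rule norm_suminf_le[OF bound]) (use geom in \<open>simp add: sums_iff\<close>)
  with geom show ?thesis by (simp add: sums_iff)
qed

text \<open>Since \<open>568 = 504 + 64\<close>, the hypothesis says that 504 times the tail bound
  is below 1.\<close>

lemma Eis_nonzero:
  assumes "568 * norm (nome z) < 1"
  shows "Eis4 z \<noteq> 0" "Eis6 z \<noteq> 0"
proof -
  let ?x = "norm (nome z)"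
  have x: "64 * ?x < 1" using assms norm_ge_zero[of "nome z"] by linarith
  have small: "504 * (?x / (1 - 64 * ?x)) < 1" using x assms by (simp add: field_simps)
  have ne: "c * T \<noteq> 1" "c * T \<noteq> - 1" if "norm T \<le> ?x / (1 - 64 * ?x)" "norm c \<le> 504" for c T :: complex
  proof -
    have "norm (c * T) \<le> 504 * (?x / (1 - 64 * ?x))" unfolding norm_mult using that by (intro mult_mono) auto
    with small have "norm (c * T) < 1" by linarith
    then show "c * T \<noteq> 1" "c * T \<noteq> - 1" by auto
  qed
  show "Eis4 z \<noteq> 0"
    using ne(2)[OF norm_sigma_tail_le[OF _ x, of 3], of 240] by (auto simp: Eis4_def add_eq_0_iff simp del: power_Suc)
  show "Eis6 z \<noteq> 0"
    using ne(1)[OF norm_sigma_tail_le[OF _ x, of 5], of 504] by (auto simp: Eis6_def simp del: power_Suc)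
qed

text \<open>Excluding -5 and -6 makes room for the numerical estimate of the nome.\<close>

lemma fundamental_discriminant_le_minus_7:
  assumes "fundamental_discriminant D" "D < - 4"
  shows "D \<le> - 7"
proof (rule ccontr)
  assume "\<not> D \<le> - 7"
  with assms(2) have "D = - 5 \<or> D = - 6" by linarith
  with assms(1) show False by (auto simp: fundamental_discriminant_def) presburger+
qed

lemma Im_cm_point:
  assumes "D < 0"
  shows "Im (cm_point D) = sqrt \<bar>of_int D\<bar> / 2"
proof -
  have "csqrt (of_int D) = \<i> * of_real (sqrt \<bar>of_int D\<bar>)"
    using csqrt_of_real_nonpos[of "of_int D"] assms by simp
  then show ?thesis by (simp add: cm_point_def)
qed

lemma norm_nome_cm_point_small:
  assumes "D \<le> - 7"
  shows "568 * norm (nome (cm_point D)) < 1"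
proof -
  \<comment> \<open>\<open>1.625 = 1 + 1/2 + 1/8\<close> is the quadratic Taylor polynomial of exp
    at 1/2; its 16th power exceeds 568.\<close>
  have "(1.625 :: real) \<le> exp (1 / 2)" using exp_lower_Taylor_quadratic[of "1/2"] by (simp add: power2_eq_square)
  then have "(1.625 :: real) ^ 16 \<le> exp (1 / 2) ^ 16" by (intro power_mono) auto
  also have "\<dots> = exp 8" by (simp flip: exp_of_nat_mult)
  also have "\<dots> \<le> exp (pi * sqrt \<bar>of_int D\<bar>)"
  proof -
    \<comment> \<open>\<open>2.64 ^ 2 < 7\<close>, while \<open>3.1 * 2.64 > 8\<close>.\<close>
    have "(2.64 :: real) \<le> sqrt \<bar>of_int D\<bar>" using assms by (intro real_le_rsqrt) (simp add: power2_eq_square)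
    moreover have "3.1 \<le> pi" using pi_approx by simp
    ultimately have "3.1 * 2.64 \<le> pi * sqrt \<bar>of_int D\<bar>" by (intro mult_mono) auto
    then show ?thesis by simp
  qed
  finally have "568 < exp (pi * sqrt \<bar>of_int D\<bar>)" by (simp add: power_numeral_reduce)
  then have "568 * inverse (exp (pi * sqrt \<bar>of_int D\<bar>)) < 1" by (simp add: field_simps)
  then show ?thesis using assms by (simp add: norm_nome Im_cm_point exp_minus)
qed

section \<open>Integrality of the recursion polynomials\<close>

definition coeffs_in :: "complex set \<Rightarrow> complex poly set" where
  "coeffs_in R = {p. \<forall>i. Polynomial.coeff p i \<in> R}"

context
  fixes K :: "complex set"
  assumes K: "number_field K"
begin

lemma coeffs_in_ring_of_integers:
  shows coeffs_in_add: "p \<in> coeffs_in (ring_of_integers K) \<Longrightarrow> q \<in> coeffs_in (ring_of_integers K) \<Longrightarrow>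
      p + q \<in> coeffs_in (ring_of_integers K)"
    and coeffs_in_mult: "p \<in> coeffs_in (ring_of_integers K) \<Longrightarrow> q \<in> coeffs_in (ring_of_integers K) \<Longrightarrow>
      p * q \<in> coeffs_in (ring_of_integers K)"
    and coeffs_in_pderiv: "p \<in> coeffs_in (ring_of_integers K) \<Longrightarrow> pderiv p \<in> coeffs_in (ring_of_integers K)"
    and coeffs_in_pCons: "a \<in> ring_of_integers K \<Longrightarrow> p \<in> coeffs_in (ring_of_integers K) \<Longrightarrow>
      pCons a p \<in> coeffs_in (ring_of_integers K)"
    and coeffs_in_0: "0 \<in> coeffs_in (ring_of_integers K)"
  by (auto simp: coeffs_in_def coeff_mult coeff_pderiv coeff_pCons split: nat.splits simp del: of_nat_Suc
      intro!: ring_of_integers_add ring_of_integers_mult ring_of_integers_sum ring_of_integers_of_nat ring_of_integers_0 K)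

lemma coeffs_in_pcompose:
  assumes p: "p \<in> coeffs_in (ring_of_integers K)" and q: "q \<in> coeffs_in (ring_of_integers K)"
  shows "pcompose p q \<in> coeffs_in (ring_of_integers K)"
  using p
proof (induction p)
  case (pCons a p)
  have "a \<in> ring_of_integers K" "p \<in> coeffs_in (ring_of_integers K)"
  proof -
    show "a \<in> ring_of_integers K" using pCons.prems by (auto simp: coeffs_in_def dest: spec[of _ 0])
    show "p \<in> coeffs_in (ring_of_integers K)" using pCons.prems by (auto simp: coeffs_in_def dest: spec[of _ "Suc _"])
  qed
  then show ?case using pCons.IH q
    by (simp add: pcompose_pCons coeffs_in_add coeffs_in_mult coeffs_in_pCons coeffs_in_0)
qed (simp add: coeffs_in_0)

lemma coeffs_in_of_nat: "of_nat n \<in> coeffs_in (ring_of_integers K)"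
  unfolding of_nat_poly by (intro coeffs_in_pCons coeffs_in_0 ring_of_integers_of_nat K)

text \<open>The polynomial \<open>a3\<close> itself need not have integral coefficients: it only occurs multiplied by the derivative
  of a polynomial in \<open>U\<close>.\<close>

lemma recursion_coeffs_in:
  fixes U a1 a2 a3 a4 :: "complex poly" and q :: "nat \<Rightarrow> complex poly"
  assumes U: "U \<in> coeffs_in (ring_of_integers K)"
    and A: "A1 \<in> coeffs_in (ring_of_integers K)" "A2 \<in> coeffs_in (ring_of_integers K)"
      "A3 \<in> coeffs_in (ring_of_integers K)" "A4 \<in> coeffs_in (ring_of_integers K)"
    and a: "a1 = pcompose A1 U" "a2 = pcompose A2 U" "a3 * pderiv U = pcompose A3 U" "a4 = pcompose A4 U"
    and q: "q 0 = 1" "q 1 = a1"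
      "\<And>n. n \<ge> 1 \<Longrightarrow> q (n + 1) = (a1 + of_nat n * a2) * q n + a3 * pderiv (q n)
         + of_nat (n * (n + 11)) * a4 * q (n - 1)"
  shows "q n \<in> coeffs_in (ring_of_integers K)"
proof -
  let ?O = "coeffs_in (ring_of_integers K)"
  have "\<exists>V\<in>?O. \<exists>W\<in>?O. q n = pcompose V U \<and> q (Suc n) = pcompose W U" for n
  proof (induction n)
    case 0
    have "1 \<in> ?O" using coeffs_in_of_nat[of 1] by simp
    with A(1) q(1,2) a(1) show ?case by (intro bexI[of _ 1] bexI[of _ A1]) auto
  next
    case (Suc n)
    then obtain V W where VW: "V \<in> ?O" "W \<in> ?O" "q n = pcompose V U" "q (Suc n) = pcompose W U" by blast
    \<comment> \<open>The recursion in the variable \<open>U\<close>: by the chain rule the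
      derivative of \<open>q (Suc n)\<close> carries the factor \<open>pderiv U\<close>, which
      together with \<open>a3\<close> gives \<open>A3\<close>.\<close>
    define X where "X = (A1 + of_nat (Suc n) * A2) * W + A3 * pderiv W + of_nat (Suc n * (Suc n + 11)) * A4 * V"
    have of_nat_U: "pcompose (of_nat m) U = of_nat m" for m by (simp add: of_nat_poly)
    have "q (Suc (Suc n)) = (a1 + of_nat (Suc n) * a2) * q (Suc n) + a3 * pderiv (q (Suc n))
         + of_nat (Suc n * (Suc n + 11)) * a4 * q n"
      using q(3)[of "Suc n"] by simp
    also have "a3 * pderiv (q (Suc n)) = pcompose (A3 * pderiv W) U"
      by (simp add: VW(4) pderiv_pcompose pcompose_mult mult_ac flip: a(3))
    finally have "q (Suc (Suc n)) = pcompose X U"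
      by (simp only: X_def pcompose_add pcompose_mult of_nat_U VW a)
    moreover have "X \<in> ?O"
      unfolding X_def by (intro coeffs_in_add coeffs_in_mult coeffs_in_pderiv coeffs_in_of_nat A VW)
    ultimately show ?case using VW by blast
  qed
  then obtain V where "V \<in> ?O" "q n = pcompose V U" by blast
  then show ?thesis by (simp add: coeffs_in_pcompose U)
qed

end

section \<open>The recursion at a CM point\<close>

text \<open>In the application \<open>r\<close> is the square root of |D| and
  \<open>\<kappa>\<close> one of \<open>k2\<close>, so \<open>\<kappa> * \<Omega> ^ 2\<close> is a
  root of \<open>Eis4 z\<close>. The condition on \<open>c\<close> makes the shifted E2 vanish at
  \<open>w = 0\<close>.\<close>

lemma taylor_coeff_by_recursion:
  fixes z \<kappa> r c c1 c3 l :: complex and \<Omega> :: real and a1 a2 a3 a4 :: "complex poly" and q :: "nat \<Rightarrow> complex poly"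
  assumes z: "Im z > 0"
    and E: "Eis2_star z * r = c1 * of_real \<Omega> ^ 2" "Eis4 z = \<kappa> ^ 2 * of_real \<Omega> ^ 4"
      "Eis6 z = c3 * r * of_real \<Omega> ^ 6"
    and nz: "Eis4 z \<noteq> 0" "r \<noteq> 0" "l \<noteq> 0"
    and c: "c * (c3 * r ^ 2) = c1 * \<kappa> ^ 2"
    and a1: "\<And>t. poly a1 t = l * c * (r / \<kappa> ^ 3 * (t + c3))"
    and a2: "\<And>t. poly a2 t = l * (c - 1) * (r / \<kappa> ^ 3 * (t + c3)) / 6"
    and a3: "\<And>t. poly a3 t = l * ((r / \<kappa> ^ 3 * (t + c3)) ^ 2 - 1) / (2 * (r / \<kappa> ^ 3))"
    and a4: "\<And>t. poly a4 t = - (l ^ 2) * (1 - 6 * c + (r / \<kappa> ^ 3 * (t + c3)) ^ 2 * (c ^ 2 + 4 * c)) / 144"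
    and q: "q 0 = 1" "q 1 = a1"
      "\<And>n. n \<ge> 1 \<Longrightarrow> q (n + 1) = (a1 + of_nat n * a2) * q n + a3 * pderiv (q n)
         + of_nat (n * (n + 11)) * a4 * q (n - 1)"
  shows "taylor_coeff z modular_Delta n = (2 * \<i> * Im z) ^ 6 * modular_Delta z
    * (- 4 * of_real pi * of_real (Im z) * (\<kappa> * of_real \<Omega> ^ 2 / l)) ^ n * poly (q n) 0 / fact n"
proof -
  define P Q R where "P = disc_E2 z" and "Q = disc_pullback 4 Eis4 z" and "R = disc_pullback 6 Eis6 z"
  define D where "D w = (2 * \<i> * Im z) ^ 6 * disc_pullback 12 modular_Delta z w" for w
  define C :: complex where "C = - 4 * of_real pi * of_real (Im z)"
  \<comment> \<open>Dividing by \<open>Q 0\<close> puts the argument at 1 for \<open>w = 0\<close>,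
    so the principal root is holomorphic near 0; \<open>S\<close> below avoids its branch
    cut.\<close>
  define Y where "Y w = \<kappa> * of_real \<Omega> ^ 2 * csqrt (Q w / Q 0)" for w
  define S0 where "S0 = (- {1}) \<inter> disc_param z -` {u. Im u > 0}"
  define S where "S = S0 \<inter> (\<lambda>w. Q w / Q 0) -` (- \<real>\<^sub>\<le>\<^sub>0)"
  have \<kappa>: "\<kappa> \<noteq> 0" "\<Omega> \<noteq> 0" using nz(1) E(2) by auto
  have Q0: "Q 0 = \<kappa> ^ 2 * of_real \<Omega> ^ 4" "Q 0 \<noteq> 0" using E(2) nz(1) by (simp_all add: Q_def)
  have "continuous_on (- {1}) (disc_param z)"
    by (intro continuous_at_imp_continuous_on ballI DERIV_isCont[OF disc_param_deriv]) simp
  then have S0: "open S0"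
    unfolding S0_def by (intro continuous_open_preimage open_halfspace_Im_gt) auto
  have ode: "(disc_pullback 12 modular_Delta z has_field_derivative C * (P w * disc_pullback 12 modular_Delta z w)) (at w)"
    "(P has_field_derivative C * ((P w ^ 2 - Q w) / 12)) (at w)"
    "(Q has_field_derivative C * ((P w * Q w - R w) / 3)) (at w)"
    "(R has_field_derivative C * ((P w * R w - Q w ^ 2) / 2)) (at w)" if "w \<in> S0" for w
    using disc_ramanujan[OF z, of w] that unfolding P_def Q_def R_def C_def S0_def by auto
  have "continuous_on S0 Q"
    by (intro continuous_at_imp_continuous_on ballI DERIV_isCont[OF ode(3)])
  then have "continuous_on S0 (\<lambda>w. Q w / Q 0)"
    using Q0(2) by (intro continuous_on_divide continuous_on_const) auto
  then have S: "open S"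
    unfolding S_def by (intro continuous_open_preimage S0) auto
  have "0 \<in> S" using z Q0(2) by (simp add: S_def S0_def)
  have Y: "Y w ^ 2 = Q w" "Y w \<noteq> 0"
    and Y': "(Y has_field_derivative C * ((P w * Q w - R w) / 3) / (2 * Y w)) (at w)" if w: "w \<in> S" for w
  proof -
    have "w \<in> S0" and ratio: "Q w / Q 0 \<notin> \<real>\<^sub>\<le>\<^sub>0" using w by (auto simp: S_def)
    have "Y w ^ 2 = (\<kappa> ^ 2 * of_real \<Omega> ^ 4) * (Q w / Q 0)"
      by (simp add: Y_def power_mult_distrib flip: power_mult)
    then show Y2: "Y w ^ 2 = Q w" using Q0 by simp
    have "Q w \<noteq> 0" using ratio by auto
    with Y2 show "Y w \<noteq> 0" by auto
    have "((\<lambda>w. csqrt (Q w / Q 0)) has_field_derivative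
        inverse (2 * csqrt (Q w / Q 0)) * (C * ((P w * Q w - R w) / 3) / Q 0)) (at w)"
      by (rule DERIV_chain2[where f = csqrt and g = "\<lambda>w. Q w / Q 0", OF has_field_derivative_csqrt[OF ratio]
            DERIV_cdivide[OF ode(3)[OF \<open>w \<in> S0\<close>]]])
    then have "(Y has_field_derivative \<kappa> * of_real \<Omega> ^ 2 *
        (inverse (2 * csqrt (Q w / Q 0)) * (C * ((P w * Q w - R w) / 3) / Q 0))) (at w)"
      unfolding Y_def[abs_def] by (rule DERIV_cmult)
    also have "\<kappa> * of_real \<Omega> ^ 2 * (inverse (2 * csqrt (Q w / Q 0)) * (C * ((P w * Q w - R w) / 3) / Q 0)) =
        C * ((P w * Q w - R w) / 3) / (2 * Y w)"
    proof -
      define y A where "y = csqrt (Q w / Q 0)" and "A = \<kappa> * of_real \<Omega> ^ 2"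
      have nz: "y \<noteq> 0" "A \<noteq> 0" using \<open>Y w \<noteq> 0\<close> by (auto simp: Y_def y_def A_def)
      have QA: "Q 0 = A * A" unfolding Q0(1) A_def by Groebner_Basis.algebra
      have "A * (inverse (2 * y) * (X / Q 0)) = X / (2 * (A * y))" for X
        unfolding QA using nz by (simp add: field_simps)
      then show ?thesis by (simp only: Y_def y_def A_def)
    qed
    finally show "(Y has_field_derivative C * ((P w * Q w - R w) / 3) / (2 * Y w)) (at w)" .
  qed
  have Y0: "Y 0 = \<kappa> * of_real \<Omega> ^ 2" using Q0(2) by (simp add: Y_def)
  have D': "(D has_field_derivative C * (P w * D w)) (at w)" if "w \<in> S0" for w
    unfolding D_def[abs_def] by (rule DERIV_cong[OF DERIV_cmult[OF ode(1)[OF that]]]) (simp add: mult_ac)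
  have "(deriv ^^ n) D 0 = C ^ n * D 0 * (Y 0 / l) ^ n * poly (q n) 0"
  proof (rule higher_deriv_by_recursion[OF S \<open>0 \<in> S\<close> D' ode(2) ode(4) Y' Y _ nz(3) a1 a2 a3 a4 q])
    show "r / \<kappa> ^ 3 \<noteq> 0" using nz \<kappa> by simp
    have PR: "P 0 * r = c1 * of_real \<Omega> ^ 2" "R 0 = c3 * r * of_real \<Omega> ^ 6" using E by (simp_all add: P_def R_def)
    then have "P 0 * Q 0 * r = c * R 0 * r"
      unfolding PR(2) Q0(1) using PR(1) c by Groebner_Basis.algebra
    then show "P 0 = c * R 0 / Q 0" using nz(2) Q0(2) by (simp add: field_simps)
    have "Y 0 ^ 3 = \<kappa> ^ 3 * of_real \<Omega> ^ 6" unfolding Y0 by Groebner_Basis.algebra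
    then show "R 0 / Y 0 ^ 3 = r / \<kappa> ^ 3 * c3" using PR(2) \<kappa> by simp
  qed (auto simp: S_def)
  then have "(deriv ^^ n) D 0 = D 0 * (C * (Y 0 / l)) ^ n * poly (q n) 0"
    by (simp only: power_mult_distrib mult_ac)
  moreover have "D 0 = (2 * \<i> * Im z) ^ 6 * modular_Delta z" by (simp add: D_def)
  ultimately show ?thesis
    unfolding taylor_coeff_eq[OF less_imp_neq[OF z, symmetric]] D_def[abs_def, symmetric] by (simp only: Y0 C_def)
qed

theorem theorem5p3:
  fixes D :: int and K :: "complex set" and k0 g :: nat
    and z k1 k2 k3 m1 m2 d :: complex and \<Omega> :: real
    and a1 a2 a3 a4 :: "complex poly" and q :: "nat \<Rightarrow> complex poly"
  assumes D: "fundamental_discriminant D" "D < -4"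
    and z: "z = cm_point D"
    and \<Omega>: "\<Omega> = CS_period D"
    and d: "d = of_int \<bar>D\<bar>"
    and k1: "Eis2_star z = k1 / sqrt \<bar>of_int D\<bar> * \<Omega> ^ 2"
    and k2: "Eis4 z = k2 * \<Omega> ^ 4"
    and k3: "Eis6 z = k3 * sqrt \<bar>of_int D\<bar> * \<Omega> ^ 6"
    and K: "number_field K" "k1 \<in> K" "k2 \<in> K" "k3 \<in> K"
    and k0: "k0 > 0" "of_nat k0 * k1 \<in> ring_of_integers K"
      "of_nat k0 * k2 \<in> ring_of_integers K" "of_nat k0 * k3 * d \<in> ring_of_integers K"
    and g: "g > 0" "of_nat g * m1 = of_nat k0 ^ 2 * k1 * k2"
      "of_nat g * m2 = of_nat k0 ^ 2 * d * k3"
    and m: "m1 \<in> ring_of_integers K" "m2 \<in> ring_of_integers K"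
      "\<not> (\<exists>e::nat. e > 1 \<and> m1 / of_nat e \<in> ring_of_integers K \<and> m2 / of_nat e \<in> ring_of_integers K)"
    and a1: "a1 = [:12 * of_nat k0 ^ 4 * k2 * m1 * d:] * [:k3, 1:]"
    and a2: "a2 = [:2 * of_nat k0 ^ 4 * k2 * (m1 - m2) * d:] * [:k3, 1:]"
    and a3: "a3 = [:6 * of_nat k0 ^ 4 * m2:] * ([:k2 * d:] * ([:k3, 1:] ^ 2) - [:k2 ^ 4:])"
    and a4: "a4 = [:- (of_nat k0 ^ 8 * k2 ^ 5 * m2 * (m2 - 6 * m1) * d):]
      - [:of_nat k0 ^ 8 * k2 ^ 2 * m1 * (4 * m2 + m1) * d ^ 2:] * ([:k3, 1:] ^ 2)"
    and q: "q 0 = 1" "q 1 = a1"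
      "\<And>n. n \<ge> 1 \<Longrightarrow> q (n + 1) = (a1 + of_nat n * a2) * q n + a3 * pderiv (q n)
         + of_nat (n * (n + 11)) * a4 * q (n - 1)"
  shows "\<forall>n. (\<forall>i. Polynomial.coeff (q n) i \<in> ring_of_integers K) \<and>
    taylor_coeff z modular_Delta n =
      - (d ^ 3) * modular_Delta z
        * (- pi * \<Omega> ^ 2 / (6 * of_nat k0 ^ 4 * k2 ^ 2 * m2)) ^ n
        * poly (q n) 0 / fact n"
proof -
  define r :: complex where "r = of_real (sqrt \<bar>of_int D\<bar>)"
  define \<kappa> where "\<kappa> = csqrt k2"
  \<comment> \<open>The scale for which \<open>a1 = l * (m1 / m2) * u\<close>, where \<open>u = (t + k3) * r / \<kappa> ^ 3\<close> stands for \<open>E6 / E4 powr (3 / 2)\<close>.\<close>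
  define l where "l = 12 * of_nat k0 ^ 4 * \<kappa> ^ 5 * m2 * r"
  have D7: "D \<le> - 7" by (rule fundamental_discriminant_le_minus_7[OF D])
  have Imz: "of_real (Im z) = r / 2" "Im z > 0"
    using D7 by (simp_all add: z Im_cm_point r_def)
  have r2: "r ^ 2 = d" by (simp add: r_def d flip: of_real_power of_int_abs)
  have r0: "r \<noteq> 0" using D7 by (simp add: r_def)
  have d0: "d \<noteq> 0" using r2 r0 by auto
  have nz: "Eis4 z \<noteq> 0" "Eis6 z \<noteq> 0"
    using Eis_nonzero[OF norm_nome_cm_point_small[OF D7]] by (simp_all add: z)
  have \<kappa>2: "\<kappa> ^ 2 = k2" by (simp add: \<kappa>_def)
  have k_nz: "k2 \<noteq> 0" "k3 \<noteq> 0" "\<kappa> \<noteq> 0" using nz k2 k3 \<kappa>2 by auto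
  have m2: "m2 \<noteq> 0" using g(3) k_nz(2) d0 k0(1) by auto
  have l0: "l \<noteq> 0" using k0(1) k_nz m2 r0 by (simp add: l_def)
  have \<kappa>4: "\<kappa> ^ 4 = k2 ^ 2" by (simp flip: \<kappa>2 power_mult)
  \<comment> \<open>\<open>m1 / m2\<close> is \<open>Eis2_star z * Eis4 z / Eis6 z\<close>; the
    common factor \<open>g\<close> cancels.\<close>
  have c: "m1 / m2 * (k3 * d) = k1 * k2"
  proof -
    have "of_nat g * (m1 * (k3 * d)) = of_nat g * (m2 * (k1 * k2))"
    proof -
      have "of_nat k0 ^ 2 * (of_nat g * m1 * (k3 * d)) = of_nat k0 ^ 2 * (of_nat g * m2 * (k1 * k2))"
        unfolding g(2,3) by (simp add: mult_ac)
      then show ?thesis using k0(1) by (simp add: mult_ac)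
    qed
    then show ?thesis using g(1) m2 by (simp add: field_simps)
  qed
  have taylor: "taylor_coeff z modular_Delta n = (2 * \<i> * Im z) ^ 6 * modular_Delta z
      * (- 4 * of_real pi * of_real (Im z) * (\<kappa> * of_real \<Omega> ^ 2 / l)) ^ n * poly (q n) 0 / fact n" for n
  proof (rule taylor_coeff_by_recursion[where r = r and c = "m1 / m2" and ?c1.0 = k1 and ?c3.0 = k3, OF Imz(2) _ _ _ nz(1) r0 l0 _ _ _ _ _ q])
    show "Eis2_star z * r = k1 * of_real \<Omega> ^ 2" using k1 r0 by (simp add: r_def)
    show "Eis4 z = \<kappa> ^ 2 * of_real \<Omega> ^ 4" using k2 by (simp add: \<kappa>2)
    show "Eis6 z = k3 * r * of_real \<Omega> ^ 6" using k3 by (simp add: r_def)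
    show "m1 / m2 * (k3 * r ^ 2) = k1 * \<kappa> ^ 2" unfolding r2 \<kappa>2 by (rule c)
    fix t
    define s C T where "s = r / \<kappa> ^ 3" and "C = m1 / m2" and "T = t + k3"
    have s0: "s \<noteq> 0" using r0 k_nz(3) by (simp add: s_def)
    \<comment> \<open>Only even powers of \<open>\<kappa>\<close> and \<open>r\<close> remain in
      \<open>l * s\<close>, \<open>l / s\<close> and \<open>l ^ 2\<close>, so both square roots
      disappear from the coefficients.\<close>
    have \<kappa>5: "\<kappa> ^ 5 = \<kappa> ^ 3 * k2" "\<kappa> ^ 5 * \<kappa> ^ 5 = k2 ^ 5" "\<kappa> ^ 5 * \<kappa> ^ 3 = k2 ^ 4"
      by (simp_all flip: \<kappa>2 power_mult power_add)
    have C: "C * m2 = m1" using m2 by (simp add: C_def)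
    have ls: "l * s = 12 * of_nat k0 ^ 4 * k2 * m2 * d"
      using k_nz(3) by (simp add: l_def s_def \<kappa>5 power2_eq_square flip: r2)
    have l_s: "l / s = 12 * of_nat k0 ^ 4 * k2 ^ 4 * m2"
      using r0 k_nz(3) by (simp add: l_def s_def mult_ac flip: \<kappa>5(3))
    have l2: "l ^ 2 = 144 * of_nat k0 ^ 8 * k2 ^ 5 * m2 ^ 2 * d"
      unfolding \<kappa>5(2)[symmetric] r2[symmetric] l_def by Groebner_Basis.algebra
    have poly_a: "poly a1 t = 12 * of_nat k0 ^ 4 * k2 * m1 * d * T" "poly a2 t = 2 * of_nat k0 ^ 4 * k2 * (m1 - m2) * d * T"
      "poly a3 t = 6 * of_nat k0 ^ 4 * m2 * (k2 * d * T ^ 2 - k2 ^ 4)"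
      "poly a4 t = - (of_nat k0 ^ 8 * k2 ^ 5 * m2 * (m2 - 6 * m1) * d) - of_nat k0 ^ 8 * k2 ^ 2 * m1 * (4 * m2 + m1) * d ^ 2 * T ^ 2"
      by (simp_all add: a1 a2 a3 a4 T_def algebra_simps)
    have "l * C * (s * T) = poly a1 t"
      unfolding poly_a using ls C by Groebner_Basis.algebra
    then show "poly a1 t = l * (m1 / m2) * (r / \<kappa> ^ 3 * (t + k3))" by (simp only: s_def C_def T_def)
    have "l * (C - 1) * (s * T) / 6 = poly a2 t"
      unfolding poly_a using ls C by Groebner_Basis.algebra
    then show "poly a2 t = l * (m1 / m2 - 1) * (r / \<kappa> ^ 3 * (t + k3)) / 6" by (simp only: s_def C_def T_def)
    have "l * ((s * T) ^ 2 - 1) / (2 * s) = (l * s * T ^ 2 - l / s) / 2"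
      using s0 by (simp add: field_simps power2_eq_square)
    also have "\<dots> = poly a3 t"
      unfolding poly_a ls l_s by Groebner_Basis.algebra
    finally show "poly a3 t = l * ((r / \<kappa> ^ 3 * (t + k3)) ^ 2 - 1) / (2 * (r / \<kappa> ^ 3))" by (simp only: s_def T_def)
    have "- (l ^ 2) * (1 - 6 * C + (s * T) ^ 2 * (C ^ 2 + 4 * C)) / 144 = - (l ^ 2 * (1 - 6 * C) + (l * s) ^ 2 * T ^ 2 * (C ^ 2 + 4 * C)) / 144"
      by Groebner_Basis.algebra
    also have "\<dots> = poly a4 t"
      unfolding poly_a ls l2 C[symmetric] by Groebner_Basis.algebra
    finally show "poly a4 t = - (l ^ 2) * (1 - 6 * (m1 / m2) + (r / \<kappa> ^ 3 * (t + k3)) ^ 2 * ((m1 / m2) ^ 2 + 4 * (m1 / m2))) / 144"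
      by (simp only: s_def C_def T_def)
  qed
  have front: "(2 * \<i> * Im z) ^ 6 = - (d ^ 3)"
  proof -
    have "(2 * \<i> * Im z) ^ 6 = (\<i> * r) ^ 6" by (simp add: Imz)
    also have "\<dots> = - ((r ^ 2) ^ 3)" by (simp add: power_mult_distrib i_even_power flip: power_mult)
    finally show ?thesis by (simp add: r2)
  qed
  \<comment> \<open>The factors \<open>\<kappa>\<close> and \<open>r\<close> of \<open>l\<close>
    cancel against the root of E4 and against \<open>Im z\<close>.\<close>
  have base: "- 4 * of_real pi * of_real (Im z) * (\<kappa> * of_real \<Omega> ^ 2 / l) =
      - pi * \<Omega> ^ 2 / (6 * of_nat k0 ^ 4 * k2 ^ 2 * m2)"
  proof -
    have "l = \<kappa> * r * (12 * of_nat k0 ^ 4 * k2 ^ 2 * m2)"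
      unfolding l_def \<kappa>4[symmetric] by Groebner_Basis.algebra
    then show ?thesis
      unfolding Imz(1) using r0 k_nz(3) by simp
  qed
  have "q n \<in> coeffs_in (ring_of_integers K)" for n
  proof (rule recursion_coeffs_in[OF K(1) _ _ _ _ _ _ _ _ _ q])
    \<comment> \<open>This is \<open>k0 * d * (t + k3)\<close>. In \<open>?A1\<close> to
      \<open>?A4\<close> each \<open>k2\<close> is paired with one \<open>k0\<close>; the other
      powers of \<open>k0\<close> and \<open>d\<close> go into \<open>?U\<close> or stay as integer
      factors.\<close>
    let ?U = "[:of_nat k0 * k3 * d, of_nat k0 * d:]"
    let ?A1 = "[:0, 12 * of_nat k0 ^ 2 * (of_nat k0 * k2) * m1:]"
    let ?A2 = "[:0, 2 * of_nat k0 ^ 2 * (of_nat k0 * k2) * (m1 + (- m2)):]"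
    let ?A3 = "[:- (6 * of_nat k0 * m2 * (of_nat k0 * k2) ^ 4 * d), 0, 6 * of_nat k0 ^ 2 * m2 * (of_nat k0 * k2):]"
    let ?A4 = "[:- (of_nat k0 ^ 3 * (of_nat k0 * k2) ^ 5 * m2 * (m2 + (- (6 * m1))) * d), 0,
        - (of_nat k0 ^ 4 * (of_nat k0 * k2) ^ 2 * m1 * (4 * m2 + m1)):]"
    have "d = of_nat (nat \<bar>D\<bar>)" by (simp add: d)
    with ring_of_integers_of_nat[OF K(1), of "nat \<bar>D\<bar>"] have dO: "d \<in> ring_of_integers K" by (simp only:)
    note closed = coeffs_in_pCons[OF K(1)] coeffs_in_0[OF K(1)] ring_of_integers_add[OF K(1)] ring_of_integers_mult[OF K(1)]
      ring_of_integers_uminus[OF K(1)] ring_of_integers_power[OF K(1)] ring_of_integers_of_nat[OF K(1)]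
      ring_of_integers_numeral[OF K(1)] ring_of_integers_0[OF K(1)] dO k0(3,4) m(1,2)
    show "?U \<in> coeffs_in (ring_of_integers K)" "?A1 \<in> coeffs_in (ring_of_integers K)"
      "?A2 \<in> coeffs_in (ring_of_integers K)" "?A3 \<in> coeffs_in (ring_of_integers K)"
      "?A4 \<in> coeffs_in (ring_of_integers K)"
      by (intro closed)+
    have eqI: "p = p'" if "\<And>x. poly p x = poly p' x" for p p' :: "complex poly"
      using that by (simp add: poly_eq_poly_eq_iff[symmetric] fun_eq_iff)
    have U: "poly ?U x = of_nat k0 * d * (k3 + x)" for x by (simp add: algebra_simps)
    have dU: "poly (pderiv ?U) x = of_nat k0 * d" for x by (simp add: pderiv_pCons)
    show "a1 = pcompose ?A1 ?U"
      by (rule eqI) (simp only: poly_pcompose poly_pCons U a1 poly_mult poly_0, simp, Groebner_Basis.algebra)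
    show "a2 = pcompose ?A2 ?U"
      by (rule eqI) (simp only: poly_pcompose poly_pCons U a2 poly_mult poly_0, simp, Groebner_Basis.algebra)
    show "a3 * pderiv ?U = pcompose ?A3 ?U"
      by (rule eqI) (simp only: poly_pcompose poly_pCons U dU a3 poly_mult poly_diff poly_power poly_0, simp, Groebner_Basis.algebra)
    show "a4 = pcompose ?A4 ?U"
      by (rule eqI) (simp only: poly_pcompose poly_pCons U a4 poly_mult poly_diff poly_power poly_0, simp, Groebner_Basis.algebra)
  qed
  then show ?thesis
    unfolding taylor front base by (simp add: coeffs_in_def)
qed

end
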